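(* Let $\Omega$ be a function on $(\mathbb{R}^n)^m$ satisfying the following three conditions. (i) $\Omega(\lambda\vec y)=\Omega(\vec y)$ for all $\lambda>0$ and $\vec y=(y_1,\dots,y_m)\in(\mathbb{R}^n)^m$. (ii) There are $0<\beta<1$ and $C_0>0$ such that $|\Omega(\xi)-\Omega(\eta)|\le C_0|\xi'-\eta'|^{\beta}$ for all nonzero $\xi,\eta\in(\mathbb{R}^n)^m$, where $(y_1,\dots,y_m)'=\frac{(y_1,\dots,y_m)}{|y_1|+\cdots+|y_m|}$. (iii) $\int_{S^{n-1}}\Omega(y_1,\dots,y_m)\,dy_j=0$ for each $j=1,\dots,m$ (for all values of the remaining variables). Suppose that the multilinear Marcinkiewicz integral $\mu$ associated with $\Omega$ is bounded from $L^{q_1}(\mathbb{R}^n)\times\cdots\times L^{q_m}(\mathbb{R}^n)$ to $L^q(\mathbb{R}^n)$ for some $1<q_1,\dots,q_m<\infty$ with $1/q=1/q_1+\cdots+1/q_m$. Let $\alpha_1,\dots,\alpha_m>0$ and $\alpha=\alpha_1+\cdots+\alpha_m$, and suppose $0<\alpha<\beta/2$. Then there is a constant $C>0$, independent of $\vec f$, such that for all $\vec f=(f_1,\dots,f_m)$ with $f_j\in Lip_{\alpha_j}(\mathbb{R}^n)$, $j=1,\dots,m$, the function $\mu(\vec f)$ is either infinite everywhere or finite almost everywhere, and in the latter case $$\|\mu(\vec f)\|_{Lip_\alpha}\le C\prod_{j=1}^m\|f_j\|_{Lip_{\alpha_j}}.$$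
   Context: For $t>0$ let $B(x,t)=\{y\in\mathbb{R}^n:|y-x|\le t\}$, and for $\vec y=(y_1,\dots,y_m)\in(\mathbb{R}^n)^m$ let $|\vec y|=|y_1|+\cdots+|y_m|$. For $\vec f=(f_1,\dots,f_m)$ define $$F_t(\vec f)(x)=\frac1{t^m}\int_{(B(0,t))^m}\frac{\Omega(\vec y)}{|\vec y|^{m(n-1)}}\prod_{i=1}^m f_i(x-y_i)\,d\vec y .$$ The multilinear Marcinkiewicz integral associated with $\Omega$ is $$\mu(\vec f)(x)=\Big(\int_0^\infty|F_t(\vec f)(x)|^2\,\frac{dt}{t}\Big)^{1/2}\in[0,\infty].$$ These are defined for Schwartz functions $f_i$ and, by the same formulas, for the $f_i$ in the function spaces considered. Boundedness of $\mu$ from $L^{q_1}\times\cdots\times L^{q_m}$ to $L^q$ means $\|\mu(\vec f)\|_{L^q}\le C\prod_i\|f_i\|_{L^{q_i}}$ with $C$ independent of $\vec f$. For $0<\alpha<1$, $Lip_\alpha(\mathbb{R}^n)$ is the homogeneous Lipschitz (Hölder) space with norm $\|f\|_{Lip_\alpha}=\sup_{x\ne y}\frac{|f(x)-f(y)|}{|x-y|^\alpha}$. It coincides, with equivalent norms and up to modification on null sets, with the Campanato space $\mathcal{E}^{\alpha,p}(\mathbb{R}^n)$, $1\le p<\infty$, with norm $\sup_B|B|^{-\alpha/n}\big(\frac1{|B|}\int_B|f-f_B|^p\,dx\big)^{1/p}$, where the supremum is over balls $B$ and $f_B=\frac1{|B|}\int_Bf(x)\,dx$. *)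

theory Defs
  imports "HOL-Analysis.Analysis"
begin

text \<open>
  Throughout, \<open>n = CARD('n)\<close> and \<open>m = CARD('m)\<close>, and the space of \<open>m\<close>-tuples of points of
  Euclidean \<open>n\<close>-space is the type \<open>(real^'n)^'m\<close>, whose Lebesgue measure is the product measure.
  Functions are complex-valued.
\<close>

text \<open>The size of a tuple is the sum of the Euclidean norms of its entries; the library's
  \<open>norm\<close> on \<open>(real^'n)^'m\<close> is the Euclidean norm instead.\<close>

definition tuple_size :: "(real^'n)^'m \<Rightarrow> real" where
  "tuple_size y = (\<Sum>i\<in>UNIV. norm (y $ i))"

definition tuple_normalize :: "(real^'n)^'m \<Rightarrow> (real^'n)^'m" where
  "tuple_normalize y = y /\<^sub>R tuple_size y"

definition tuple_upd :: "'a^'m \<Rightarrow> 'm \<Rightarrow> 'a \<Rightarrow> 'a^'m" where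
  "tuple_upd y j v = (\<chi> i. if i = j then v else y $ i)"

text \<open>Surface measure on the unit sphere, given by polar coordinates: the measure of \<open>A\<close> is
  \<open>n\<close> times the volume of the cone \<open>{r *\<^sub>R a | 0 < r < 1, a \<in> A}\<close>. For \<open>n = 1\<close> this is counting
  measure on the two points \<open>1\<close> and \<open>-1\<close>.\<close>

definition sphere_measure :: "(real^'n) measure" where
  "sphere_measure =
     scale_measure (of_nat CARD('n))
       (distr (restrict_space lborel (ball 0 1 - {0})) (restrict_space borel (sphere 0 1))
          (\<lambda>x. x /\<^sub>R norm x))"

text \<open>Real powers on \<open>[0,\<infinity>]\<close>; only used with positive exponents.\<close>

definition epowr :: "ennreal \<Rightarrow> real \<Rightarrow> ennreal" where
  "epowr x a = (if x = \<infinity> then \<infinity> else ennreal (enn2real x powr a))"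

text \<open>The \<open>L\<^sup>p\<close> (quasi-)norm, \<open>0 < p < \<infinity>\<close>, of a function with values in \<open>[0,\<infinity>]\<close>. The target
  exponent of a multilinear operator may be less than \<open>1\<close>.\<close>

definition Lp_enorm :: "real \<Rightarrow> (real^'n \<Rightarrow> ennreal) \<Rightarrow> ennreal" where
  "Lp_enorm p h = epowr (\<integral>\<^sup>+x. epowr (h x) p \<partial>lebesgue) (1/p)"

definition Lp_norm :: "real \<Rightarrow> (real^'n \<Rightarrow> complex) \<Rightarrow> ennreal" where
  "Lp_norm p f = Lp_enorm p (\<lambda>x. ennreal (norm (f x)))"

definition Lp_space :: "real \<Rightarrow> (real^'n \<Rightarrow> complex) set" where
  "Lp_space p = {f. f \<in> borel_measurable lebesgue \<and> Lp_norm p f < \<infinity>}"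

definition Lip_norm :: "real \<Rightarrow> (real^'n \<Rightarrow> 'b::real_normed_vector) \<Rightarrow> ennreal" where
  "Lip_norm \<alpha> f = (SUP (x, y) \<in> {(x, y). x \<noteq> y}. ennreal (norm (f x - f y) / norm (x - y) powr \<alpha>))"

definition Lip_space :: "real \<Rightarrow> (real^'n \<Rightarrow> 'b::real_normed_vector) set" where
  "Lip_space \<alpha> = {f. Lip_norm \<alpha> f < \<infinity>}"

definition marcinkiewicz_avg ::
    "((real^'n)^'m \<Rightarrow> complex) \<Rightarrow> ('m \<Rightarrow> real^'n \<Rightarrow> complex) \<Rightarrow> real \<Rightarrow> real^'n \<Rightarrow> complex" where
  "marcinkiewicz_avg \<Omega> f t x =
     1 / of_real (t ^ CARD('m)) *
     (LINT y:{y. \<forall>i. y $ i \<in> cball 0 t}|lebesgue.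
        \<Omega> y / of_real (tuple_size y ^ (CARD('m) * (CARD('n) - 1))) * (\<Prod>i\<in>UNIV. f i (x - y $ i)))"

definition marcinkiewicz ::
    "((real^'n)^'m \<Rightarrow> complex) \<Rightarrow> ('m \<Rightarrow> real^'n \<Rightarrow> complex) \<Rightarrow> real^'n \<Rightarrow> ennreal" where
  "marcinkiewicz \<Omega> f x =
     epowr (\<integral>\<^sup>+t\<in>{0<..}. ennreal ((norm (marcinkiewicz_avg \<Omega> f t x))\<^sup>2 / t) \<partial>lebesgue) (1/2)"

definition marcinkiewicz_bounded ::
    "((real^'n)^'m \<Rightarrow> complex) \<Rightarrow> ('m \<Rightarrow> real) \<Rightarrow> real \<Rightarrow> bool" where
  "marcinkiewicz_bounded \<Omega> qs q \<longleftrightarrow>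
     (\<exists>C::real. \<forall>f. (\<forall>i. f i \<in> Lp_space (qs i)) \<longrightarrow>
        Lp_enorm q (marcinkiewicz \<Omega> f) \<le> ennreal C * (\<Prod>i\<in>UNIV. Lp_norm (qs i) (f i)))"

end

theory Submission
  imports Defs
begin

text \<open>
  Write \<open>k(y) = \<Omega>(y) / |y|^(m(n-1))\<close> for \<open>|y_1|, \<dots>, |y_m| \<le> 1\<close> and \<open>k = 0\<close> elsewhere. Dilating the
  variable by \<open>t\<close> turns the averages into \<open>F_t(f)(x) = \<integral> k(y) \<Prod>_i f_i(x - t y_i) dy\<close> with one fixed
  integrable kernel (\<open>marcinkiewicz_avg_eq_dilated_avg\<close>).

  For fixed values of the other variables, \<open>k\<close> has integral zero over every sphere in the variable
  \<open>y_j\<close>. Hence \<open>f_j\<close> may be replaced by \<open>f_j - c_j\<close> for any constants \<open>c_j\<close> without changing the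
  average (\<open>integral_kernel_prod_shift\<close>). The choice \<open>c_j = f_j(x)\<close> shows that
  \<open>|F_t(f)(x)| \<le> C \<Lambda> t^\<alpha>\<close>, where \<open>\<Lambda>\<close> is the product of the Lipschitz norms.

  To compare two points \<open>x\<close> and \<open>z\<close>, recentre both averages at the values \<open>f_j(x)\<close> and translate the
  variable in the second one, so that both integrals contain the same product of increments. Their
  difference is the integral of \<open>k(y) - k(y + w)\<close>, where every entry of \<open>w\<close> is \<open>(z - x)/t\<close>, against
  a product of size at most \<open>\<Lambda> (2t)^\<alpha>\<close>. The regularity of \<open>\<Omega>\<close> makes the \<open>L\<^sup>1\<close> modulus of continuity
  of \<open>k\<close> of order \<open>\<beta>\<close> (\<open>integral_kernel_diff_le\<close>), whence
  \<open>|F_t(f)(x) - F_t(f)(z)| \<le> C \<Lambda> t^\<alpha> min(1, (|x - z|/t)^\<beta>)\<close>.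

  As \<open>0 < \<alpha> < \<beta>\<close>, the square of this bound is integrable against \<open>dt/t\<close> at both ends, with integral
  \<open>C \<Lambda>\<^sup>2 |x - z|^(2\<alpha>)\<close> (\<open>square_integral_diff_le\<close>). The triangle inequality in \<open>L\<^sup>2(dt/t)\<close> then gives
  \<open>\<mu>(f)(x) \<le> \<mu>(f)(z) + C \<Lambda> |x - z|^\<alpha>\<close>: if \<open>\<mu>(f)\<close> is finite at one point, it is finite at every
  point and satisfies the Lipschitz estimate.
\<close>

section \<open>Dilations, translations and polar coordinates\<close>

lemma ball_in_borel [measurable]: "ball (x::'a::metric_space) r \<in> sets borel"
  by simp

lemma nn_integral_scaleR:
  fixes f :: "'a::euclidean_space \<Rightarrow> ennreal"
  assumes [measurable]: "f \<in> borel_measurable borel" and c: "c > 0"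
  shows "(\<integral>\<^sup>+x. f x \<partial>lborel) = ennreal (c ^ DIM('a)) * (\<integral>\<^sup>+x. f (c *\<^sub>R x) \<partial>lborel)"
  using c by (subst lborel_affine[of c 0])
    (simp_all add: nn_integral_density nn_integral_distr nn_integral_cmult)

lemma integral_scaleR_lborel:
  fixes f :: "'a::euclidean_space \<Rightarrow> 'b::{banach,second_countable_topology}"
  assumes [measurable]: "f \<in> borel_measurable borel" and c: "c > 0"
  shows "(\<integral>x. f x \<partial>lborel) = (c ^ DIM('a)) *\<^sub>R (\<integral>x. f (c *\<^sub>R x) \<partial>lborel)"
  using c by (subst lborel_affine[of c 0])
    (simp_all add: integral_density integral_distr)

lemma nn_integral_translate:
  fixes f :: "'a::euclidean_space \<Rightarrow> ennreal"
  assumes [measurable]: "f \<in> borel_measurable borel"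
  shows "(\<integral>\<^sup>+x. f (x + a) \<partial>lborel) = (\<integral>\<^sup>+x. f x \<partial>lborel)"
  by (subst (2) lborel_distr_plus[of a, symmetric]) (simp add: nn_integral_distr add.commute)

lemma integral_translate:
  fixes f :: "'a::euclidean_space \<Rightarrow> 'b::{banach,second_countable_topology}"
  assumes [measurable]: "f \<in> borel_measurable borel"
  shows "(\<integral>x. f (x + a) \<partial>lborel) = (\<integral>x. f x \<partial>lborel)"
  by (subst (2) lborel_distr_plus[of a, symmetric]) (simp add: integral_distr add.commute)

lemma nn_integral_power_tail:
  fixes a :: real
  assumes a: "a > 0" and N: "N > 0"
  shows "(\<integral>\<^sup>+s. indicator {a<..} s * ennreal (inverse (s ^ Suc N)) \<partial>lborel)
    = ennreal (1 / (real N * a ^ N))"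
proof -
  have "((\<lambda>s. s powr (- real N - 1)) has_integral - (a powr (- real N - 1 + 1)) / (- real N - 1
    + 1)) {a..}"
    using a N by (intro has_integral_powr_to_inf) auto
  then have "(\<integral>\<^sup>+s. ennreal (s powr (- real N - 1)) * indicator {a..} s \<partial>lborel)
      = ennreal (- (a powr (- real N - 1 + 1)) / (- real N - 1 + 1))"
    by (intro nn_integral_has_integral_lebesgue') auto
  also have "\<dots> = ennreal (1 / (real N * a ^ N))"
    using a by (simp add: powr_minus powr_realpow field_simps)
  finally have *: "(\<integral>\<^sup>+s. ennreal (s powr (- real N - 1)) * indicator {a..} s \<partial>lborel)
     = ennreal (1 / (real N * a ^ N))" .
  have "(\<integral>\<^sup>+s. indicator {a<..} s * ennreal (inverse (s ^ Suc N)) \<partial>lborel)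
     = (\<integral>\<^sup>+s. ennreal (s powr (- real N - 1)) * indicator {a..} s \<partial>lborel)"
  proof (rule nn_integral_cong_AE)
    have "AE s in lborel. s \<noteq> a" by (rule AE_lborel_singleton)
    then show "AE s in lborel. indicator {a<..} s * ennreal (inverse (s ^ Suc N))
        = ennreal (s powr (- real N - 1)) * indicator {a..} s"
    proof eventually_elim
      case (elim s)
      show ?case
      proof (cases "s > a")
        case True
        then have "s > 0" using a by simp
        moreover have "- real N - 1 = - real (Suc N)" by simp
        ultimately have "s powr (- real N - 1) = inverse (s powr (real (Suc N)))"
          by (simp only: powr_minus)
        also have "\<dots> = inverse (s ^ Suc N)"
          using \<open>s > 0\<close> by (subst powr_realpow) auto
        finally show ?thesis using True by simp
      qed (use elim in auto)
    qed
  qed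
  then show ?thesis using * by simp
qed

text \<open>
  Polar coordinates, with the direction \<open>x / |x|\<close> of a uniformly distributed point \<open>x\<close> of the
  unit ball in place of a point of the sphere. Substituting \<open>r = |x| s\<close> in the radial integral,
  exchanging the integrals and substituting \<open>u = s x\<close> in the other one turns the right-hand side
  into the integral of \<open>|u|^N h(u)\<close> against \<open>\<integral> s^(-N-1) ds\<close> over \<open>s > |u|\<close>, and this inner integral
  is \<open>|u|^(-N) / N\<close>.
\<close>

lemma nn_integral_polar:
  fixes h :: "'a::euclidean_space \<Rightarrow> ennreal"
  assumes [measurable]: "h \<in> borel_measurable borel"
  shows "(\<integral>\<^sup>+v. h v \<partial>lborel) =
    ennreal (real DIM('a)) * (\<integral>\<^sup>+x. \<integral>\<^sup>+r. indicator (ball 0 1 - {0}) x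
      * (indicator {0<..} r * ennreal (r ^ (DIM('a) - 1)))
        * h ((r / norm x) *\<^sub>R x) \<partial>lborel \<partial>lborel)"
proof -
  let ?N = "DIM('a)"
  obtain N' where N': "?N = Suc N'" using DIM_positive[where 'a='a] by (cases ?N) auto
  have radial: "(\<integral>\<^sup>+r. indicator (ball 0 1 - {0}) x * (indicator {0<..} r * ennreal (r ^ (?N - 1)))
    * h ((r / norm x) *\<^sub>R x) \<partial>lborel)
     = (\<integral>\<^sup>+s. indicator {0<..} s * ennreal (s ^ (?N - 1))
       * (indicator (ball 0 1 - {0}) x * ennreal (norm x ^ ?N) * h (s *\<^sub>R x)) \<partial>lborel)" 
    (is "?L = ?R") for x :: 'a
  proof (cases "x \<in> ball 0 1 - {0}")
    case True
    then have x: "norm x > 0" by auto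
    have "?L = ennreal (norm x) * (\<integral>\<^sup>+s. indicator (ball 0 1 - {0}) x
      * (indicator {0<..} (norm x * s) * ennreal ((norm x * s) ^ (?N - 1)))
        * h ((norm x * s / norm x) *\<^sub>R x) \<partial>lborel)"
      using x by (subst nn_integral_real_affine[where c="norm x" and t=0]) simp_all
    also have "\<dots> = ?R"
      using x by (subst nn_integral_cmult[symmetric], measurable)
        (intro nn_integral_cong, auto simp: indicator_def N' power_mult_distrib ennreal_mult'
          zero_less_mult_iff mult_ac)
    finally show ?thesis .
  qed simp
  have spatial: "(\<integral>\<^sup>+x. indicator {0<..} s * ennreal (s ^ (?N - 1))
    * (indicator (ball 0 1 - {0}) x * ennreal (norm x ^ ?N) * h (s *\<^sub>R x)) \<partial>(lborel :: 'a measure))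
     = (\<integral>\<^sup>+u. ennreal (norm u ^ ?N) * h u * (indicator {0<..} (norm u)
       * (indicator {r. norm u < r} s * ennreal (inverse (s ^ Suc ?N)))) \<partial>lborel)" 
    (is "?L = ?R") for s :: real
  proof (cases "s > 0")
    case True
    have "?R = ennreal (s ^ ?N) * (\<integral>\<^sup>+x. ennreal (norm (s *\<^sub>R x) ^ ?N) * h (s *\<^sub>R x)
      * (indicator {0<..} (norm (s *\<^sub>R x)) * (indicator {r. norm (s *\<^sub>R x) < r} s
        * ennreal (inverse (s ^ Suc ?N)))) \<partial>(lborel :: 'a measure))"
      using True by (subst nn_integral_scaleR[where c=s]) simp_all
    also have "\<dots> = ?L"
    proof (subst nn_integral_cmult[symmetric], measurable, intro nn_integral_cong)
      fix x :: 'a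
      have "s ^ ?N * (s ^ ?N * norm x ^ ?N * inverse (s ^ Suc ?N)) = s ^ (?N - 1) * norm x ^ ?N"
        using True by (simp add: N' field_simps)
      then have "ennreal (s ^ ?N) * (ennreal (s ^ ?N * norm x ^ ?N)
        * ennreal (inverse (s ^ Suc ?N))) = ennreal (s ^ (?N - 1)) * ennreal (norm x ^ ?N)"
        using True by (simp add: ennreal_mult'[symmetric] del: power_Suc)
      then show "ennreal (s ^ ?N) * (ennreal (norm (s *\<^sub>R x) ^ ?N) * h (s *\<^sub>R x)
        * (indicator {0<..} (norm (s *\<^sub>R x)) * (indicator {r. norm (s *\<^sub>R x) < r} s
          * ennreal (inverse (s ^ Suc ?N)))))
        = indicator {0<..} s * ennreal (s ^ (?N - 1))
          * (indicator (ball 0 1 - {0}) x * ennreal (norm x ^ ?N) * h (s *\<^sub>R x))"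
        using True by (auto simp: indicator_def power_mult_distrib mult_ac simp del: power_Suc)
    qed
    finally show ?thesis by simp
  next
    case False
    then have "indicator {r. norm u < r} s = (0::ennreal)" for u :: 'a
      using order_trans[OF _ norm_ge_zero[of u]] by (force simp: indicator_def)
    then show ?thesis using False by simp
  qed
  have "(\<integral>\<^sup>+x. \<integral>\<^sup>+r. indicator (ball 0 1 - {0}) x * (indicator {0<..} r * ennreal (r ^ (?N - 1)))
        * h ((r / norm x) *\<^sub>R x) \<partial>lborel \<partial>lborel)
     = (\<integral>\<^sup>+x. \<integral>\<^sup>+s. indicator {0<..} s * ennreal (s ^ (?N - 1))
       * (indicator (ball 0 1 - {0}) x * ennreal (norm x ^ ?N) * h (s *\<^sub>R x)) \<partial>lborel \<partial>lborel)"
    by (simp only: radial)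
  also have "\<dots> = (\<integral>\<^sup>+s. \<integral>\<^sup>+x. indicator {0<..} s * ennreal (s ^ (?N - 1))
    * (indicator (ball 0 1 - {0}) x * ennreal (norm x ^ ?N) * h (s *\<^sub>R x)) \<partial>lborel \<partial>lborel)"
    by (rule lborel_pair.Fubini'[symmetric]) measurable
  also have "\<dots> = (\<integral>\<^sup>+s. \<integral>\<^sup>+u. ennreal (norm u ^ ?N) * h u
    * (indicator {0<..} (norm u) * (indicator {r. norm u < r} s
      * ennreal (inverse (s ^ Suc ?N)))) \<partial>(lborel :: 'a measure) \<partial>lborel)"
    by (simp only: spatial)
  also have "\<dots> = (\<integral>\<^sup>+u. \<integral>\<^sup>+s. ennreal (norm u ^ ?N) * h u
    * (indicator {0<..} (norm u) * (indicator {r. norm u < r} s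
      * ennreal (inverse (s ^ Suc ?N)))) \<partial>lborel \<partial>(lborel :: 'a measure))"
    by (rule lborel_pair.Fubini'[symmetric]) measurable
  also have "\<dots> = (\<integral>\<^sup>+u. h u * ennreal (1 / real ?N) \<partial>lborel)"
  proof (rule nn_integral_cong_AE)
    have "AE u in lborel. u \<noteq> (0::'a)" by (rule AE_lborel_singleton)
    then show "AE u::'a in lborel. (\<integral>\<^sup>+s. ennreal (norm u ^ ?N) * h u
      * (indicator {0<..} (norm u) * (indicator {r. norm u < r} s
        * ennreal (inverse (s ^ Suc ?N)))) \<partial>lborel) = h u * ennreal (1 / real ?N)"
    proof eventually_elim
      case (elim u)
      then have u: "norm u > 0" by simp
      have "(\<integral>\<^sup>+s. ennreal (norm u ^ ?N) * h u * (indicator {0<..} (norm u)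
        * (indicator {r. norm u < r} s * ennreal (inverse (s ^ Suc ?N)))) \<partial>lborel)
         = ennreal (norm u ^ ?N) * h u * (\<integral>\<^sup>+s. indicator {norm u<..} s
           * ennreal (inverse (s ^ Suc ?N)) \<partial>lborel)"
        using u by (subst nn_integral_cmult[symmetric]) (simp_all add: greaterThan_def)
      also have "\<dots> = ennreal (norm u ^ ?N) * h u * ennreal (1 / (real ?N * norm u ^ ?N))"
        using u by (subst nn_integral_power_tail) simp_all
      also have "\<dots> = h u * ennreal (norm u ^ ?N * (1 / (real ?N * norm u ^ ?N)))"
        by (subst ennreal_mult') (simp_all add: mult_ac)
      also have "\<dots> = h u * ennreal (1 / real ?N)" using u by simp
      finally show ?case .
    qed
  qed
  also have "\<dots> = ennreal (1 / real ?N) * (\<integral>\<^sup>+u. h u \<partial>lborel)"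
    by (subst nn_integral_cmult[symmetric]) (simp_all add: mult_ac)
  finally show ?thesis
    by (simp add: mult.assoc[symmetric] ennreal_mult'[symmetric])
qed

text \<open>
  As an identity of measures the formula also applies to Bochner integrals, with Fubini's theorem
  on the product space.
\<close>

lemma lborel_polar:
  fixes w :: "'a::euclidean_space \<times> real \<Rightarrow> real"
  defines "w \<equiv> \<lambda>(x, r). real DIM('a) * (indicator (ball 0 1 - {0}) x
    * (indicator {0<..} r * r ^ (DIM('a) - 1)))"
  shows "lborel = distr (density lborel (\<lambda>p. ennreal (w p))) borel (\<lambda>(x, r). (r / norm x) *\<^sub>R x)"
proof (rule measure_eqI)
  fix A :: "'a set" assume "A \<in> sets lborel"
  then have [measurable]: "A \<in> sets borel" by simp
  define T where "T = (\<lambda>(x::'a, r::real). (r / norm x) *\<^sub>R x)"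
  have [measurable]: "T \<in> borel \<rightarrow>\<^sub>M borel" "w \<in> borel_measurable borel"
    unfolding borel_prod[symmetric] T_def w_def by measurable
  have "emeasure (distr (density lborel w) borel T) A =
    (\<integral>\<^sup>+p. indicator A p \<partial>distr (density lborel w) borel T)"
    by simp
  also have "\<dots> = (\<integral>\<^sup>+p. ennreal (w p) * indicator A (T p) \<partial>lborel)"
    by (subst nn_integral_distr) (simp_all add: nn_integral_density)
  also have "\<dots> = (\<integral>\<^sup>+p. ennreal (w p) * indicator A (T p) \<partial>(lborel \<Otimes>\<^sub>M lborel))"
    by (simp add: lborel_prod)
  also have "\<dots> = (\<integral>\<^sup>+x. \<integral>\<^sup>+r. ennreal (w (x, r)) * indicator A (T (x, r)) \<partial>lborel \<partial>lborel)"
    by (rule lborel.nn_integral_fst[symmetric]) (simp add: lborel_prod)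
  also have "\<dots> = (\<integral>\<^sup>+x. \<integral>\<^sup>+r. ennreal (real DIM('a))
    * (indicator (ball 0 1 - {0}) x * (indicator {0<..} r * ennreal (r ^ (DIM('a) - 1)))
        * indicator A ((r / norm x) *\<^sub>R x)) \<partial>lborel \<partial>lborel)"
    by (intro nn_integral_cong) (auto simp: w_def T_def ennreal_mult' indicator_def)
  also have "\<dots> = ennreal (real DIM('a)) * (\<integral>\<^sup>+x. \<integral>\<^sup>+r. indicator (ball 0 1 - {0}) x
    * (indicator {0<..} r * ennreal (r ^ (DIM('a) - 1)))
        * indicator A ((r / norm x) *\<^sub>R x) \<partial>lborel \<partial>lborel)"
    by (simp add: nn_integral_cmult del: One_nat_def)
  also have "\<dots> = emeasure lborel A"
    by (subst nn_integral_polar[symmetric]) simp_all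
  finally show "emeasure lborel A = emeasure (distr (density lborel w) borel (\<lambda>(x, r). (r / norm x)
    *\<^sub>R x)) A"
    by (simp add: T_def)
qed simp

text \<open>
  A function whose mean over every centred sphere vanishes has integral zero. Functions that are not
  integrable are covered by the convention that their Bochner integral is \<open>0\<close>.
\<close>

lemma integral_eq_0_spheres:
  fixes h :: "'a::euclidean_space \<Rightarrow> 'b::{banach,second_countable_topology}"
  assumes zero: "\<And>r. r > 0 \<Longrightarrow> (\<integral>x. indicator (ball 0 1 - {0}) x *\<^sub>R h ((r / norm x) *\<^sub>R x) \<partial>lborel)
    = 0"
  shows "(\<integral>x. h x \<partial>lborel) = 0"
proof (cases "integrable lborel h")
  case True
  then have [measurable]: "h \<in> borel_measurable borel" by auto
  define w where "w = (\<lambda>(x::'a, r::real). real DIM('a)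
    * (indicator (ball 0 1 - {0}) x * (indicator {0<..} r * r ^ (DIM('a) - 1))))"
  define T where "T = (\<lambda>(x::'a, r::real). (r / norm x) *\<^sub>R x)"
  have [measurable]: "T \<in> borel \<rightarrow>\<^sub>M borel" "w \<in> borel_measurable borel"
    unfolding borel_prod[symmetric] T_def w_def by measurable
  have w0: "w p \<ge> 0" for p by (cases p) (simp add: indicator_def w_def)
  note polar = lborel_polar[where 'a='a, folded w_def T_def]
  have "integrable (distr (density lborel w) borel T) h"
    using True polar by simp
  then have int: "integrable (lborel \<Otimes>\<^sub>M lborel) (\<lambda>p. w p *\<^sub>R h (T p))"
    using w0 by (simp add: integrable_distr_eq integrable_density lborel_prod)
  have "(\<integral>x. h x \<partial>lborel) = (\<integral>p. w p *\<^sub>R h (T p) \<partial>(lborel \<Otimes>\<^sub>M lborel))"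
    using w0 by (subst polar) (simp add: integral_distr integral_density lborel_prod)
  also have "\<dots> = (\<integral>r. (\<integral>x. w (x, r) *\<^sub>R h (T (x, r)) \<partial>lborel) \<partial>lborel)"
    using lborel_pair.integral_snd[of "\<lambda>x r. w (x, r) *\<^sub>R h (T (x, r))"] int
      by (simp add: case_prod_beta')
  also have "\<dots> = (\<integral>r. 0 \<partial>(lborel :: real measure))"
  proof (rule Bochner_Integration.integral_cong[OF refl])
    fix r :: real
    have "(\<integral>x. w (x, r) *\<^sub>R h (T (x, r)) \<partial>lborel)
      = (\<integral>x. (real DIM('a) * (indicator {0<..} r * r ^ (DIM('a) - 1))) *\<^sub>R (indicator (ball 0 1 -
        {0}) x *\<^sub>R h ((r / norm x) *\<^sub>R x)) \<partial>lborel)"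
      by (simp add: w_def T_def mult_ac)
    also have "\<dots> = (real DIM('a) * (indicator {0<..} r * r ^ (DIM('a) - 1))) *\<^sub>R
      (\<integral>x. indicator (ball 0 1 - {0}) x *\<^sub>R h ((r / norm x) *\<^sub>R x) \<partial>lborel)"
      by (rule integral_scaleR_right)
    also have "\<dots> = 0" using zero[of r] by (cases "r > 0") auto
    finally show "(\<integral>x. w (x, r) *\<^sub>R h (T (x, r)) \<partial>lborel) = 0" .
  qed
  finally show ?thesis by simp
qed (rule not_integrable_integral_eq)

text \<open>
  A substitute for Fubini's theorem along a subspace \<open>L\<close> that does not split off as a factor of the
  type: multiply \<open>G(y + L v)\<close> by the cutoff \<open>1(|P y| < 1)\<close> and integrate over \<open>(v, y)\<close>. Integrating
  over \<open>v\<close> first gives \<open>0\<close>. Translating \<open>y\<close> by \<open>L v\<close> moves the dependence on \<open>v\<close> into the cutoff,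
  and integrating over \<open>v\<close> then gives the volume of the unit ball times \<open>\<integral> G\<close>.
\<close>

lemma integral_eq_0_slices:
  fixes G :: "'a::euclidean_space \<Rightarrow> 'b::{banach,second_countable_topology}"
    and L :: "'c::euclidean_space \<Rightarrow> 'a" and P :: "'a \<Rightarrow> 'c"
  assumes G: "integrable lborel G" and L: "bounded_linear L" and P: "bounded_linear P"
    and PL: "\<And>v. P (L v) = v"
    and zero: "\<And>y. (\<integral>v. G (y + L v) \<partial>lborel) = 0"
  shows "(\<integral>y. G y \<partial>lborel) = 0"
proof -
  have [measurable]: "G \<in> borel_measurable borel" "L \<in> borel \<rightarrow>\<^sub>M borel" "P \<in> borel \<rightarrow>\<^sub>M borel"
    using G L P by (auto intro!: borel_measurable_continuous_onI linear_continuous_on)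
  let ?\<psi> = "\<lambda>y. indicator (ball 0 1) (P y) :: real"
  \<comment> \<open>\<open>?I\<close> is \<open>?J\<close> composed with the measure-preserving shear \<open>(v, y) \<mapsto> (v, y + L v)\<close>.\<close>
  let ?I = "\<lambda>(v, y). ?\<psi> y *\<^sub>R G (y + L v)"
  let ?J = "\<lambda>(v, y). indicator (ball 0 1) (P y - v) *\<^sub>R G y"
  have shift: "(\<integral>\<^sup>+v. indicator (ball 0 1) (p - v) \<partial>lborel)
    = emeasure lborel (ball (0::'c) 1)" for p :: 'c
  proof -
    have "(\<integral>\<^sup>+v. indicator (ball 0 1) (p - v) \<partial>lborel) =
      (\<integral>\<^sup>+v. indicator (ball 0 1) (v + (- p)) \<partial>(lborel::'c measure))"
      by (intro nn_integral_cong) (auto simp: indicator_def norm_minus_commute)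
    also have "\<dots> = emeasure lborel (ball (0::'c) 1)"
      by (subst nn_integral_translate) auto
    finally show ?thesis .
  qed
  have vol: "emeasure lborel (ball (0::'c) 1) < \<infinity>"
    using emeasure_lborel_ball_finite by (simp add: less_top)
  have vol0: "measure lborel (ball (0::'c) 1) > 0"
    using content_ball_pos[of 1 "0::'c"] by simp
  have J_int: "integrable (lborel \<Otimes>\<^sub>M lborel) ?J"
  proof (rule integrableI_bounded)
    have "(\<integral>\<^sup>+p. ennreal (norm (?J p)) \<partial>(lborel \<Otimes>\<^sub>M lborel)) =
      (\<integral>\<^sup>+y. \<integral>\<^sup>+v. ennreal (norm (?J (v, y))) \<partial>lborel \<partial>lborel)"
      by (subst lborel_pair.nn_integral_snd[symmetric]) (auto simp: case_prod_beta')
    also have "\<dots> = (\<integral>\<^sup>+y. ennreal (norm (G y)) * emeasure lborel (ball (0::'c) 1) \<partial>lborel)"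
    proof (rule nn_integral_cong)
      fix y
      have "(\<integral>\<^sup>+v. ennreal (norm (?J (v, y))) \<partial>lborel)
        = (\<integral>\<^sup>+v. ennreal (norm (G y)) * indicator (ball 0 1) (P y - v) \<partial>lborel)"
        by (intro nn_integral_cong) (simp add: indicator_def)
      then show "(\<integral>\<^sup>+v. ennreal (norm (?J (v, y))) \<partial>lborel) = ennreal (norm (G y))
        * emeasure lborel (ball (0::'c) 1)"
        by (simp add: nn_integral_cmult shift)
    qed
    also have "\<dots> < \<infinity>"
      using G vol by (simp add: nn_integral_multc integrable_iff_bounded ennreal_mult_less_top)
    finally show "(\<integral>\<^sup>+p. ennreal (norm (?J p)) \<partial>(lborel \<Otimes>\<^sub>M lborel)) < \<infinity>" .
  qed measurable
  have translate: "P (y + L v) - v = P y" for y v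
    using P PL by (simp add: linear_simps)
  have I_int: "integrable (lborel \<Otimes>\<^sub>M lborel) ?I"
  proof (rule integrableI_bounded)
    have "(\<integral>\<^sup>+p. ennreal (norm (?I p)) \<partial>(lborel \<Otimes>\<^sub>M lborel)) =
      (\<integral>\<^sup>+v. \<integral>\<^sup>+y. ennreal (norm (?I (v, y))) \<partial>lborel \<partial>lborel)"
      by (subst lborel.nn_integral_fst[symmetric]) auto
    also have "\<dots> = (\<integral>\<^sup>+v. \<integral>\<^sup>+y. ennreal (norm (?J (v, y + L v))) \<partial>lborel \<partial>lborel)"
      by (simp add: translate)
    also have "\<dots> = (\<integral>\<^sup>+v. \<integral>\<^sup>+y. ennreal (norm (?J (v, y))) \<partial>lborel \<partial>lborel)"
    proof (rule nn_integral_cong)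
      fix v
      show "(\<integral>\<^sup>+y. ennreal (norm (?J (v, y + L v))) \<partial>lborel) =
        (\<integral>\<^sup>+y. ennreal (norm (?J (v, y))) \<partial>lborel)"
        by (rule nn_integral_translate[where f="\<lambda>y. ennreal (norm (?J (v, y)))"]) simp
    qed
    also have "\<dots> = (\<integral>\<^sup>+p. ennreal (norm (?J p)) \<partial>(lborel \<Otimes>\<^sub>M lborel))"
      by (subst lborel.nn_integral_fst[symmetric]) auto
    also have "\<dots> < \<infinity>" using J_int by (simp add: integrable_iff_bounded)
    finally show "(\<integral>\<^sup>+p. ennreal (norm (?I p)) \<partial>(lborel \<Otimes>\<^sub>M lborel)) < \<infinity>" .
  qed measurable
  have "0 = (\<integral>y. \<integral>v. ?I (v, y) \<partial>lborel \<partial>lborel)"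
    by (simp add: zero)
  also have "\<dots> = (\<integral>v. \<integral>y. ?I (v, y) \<partial>lborel \<partial>lborel)"
    using lborel_pair.Fubini_integral[OF I_int] by simp
  also have "\<dots> = (\<integral>v. \<integral>y. ?J (v, y + L v) \<partial>lborel \<partial>lborel)"
    by (simp add: translate)
  also have "\<dots> = (\<integral>v. \<integral>y. ?J (v, y) \<partial>lborel \<partial>lborel)"
  proof (rule Bochner_Integration.integral_cong[OF refl])
    fix v
    show "(\<integral>y. ?J (v, y + L v) \<partial>lborel) = (\<integral>y. ?J (v, y) \<partial>lborel)"
      by (rule integral_translate[where f="\<lambda>y. ?J (v, y)"]) simp
  qed
  also have "\<dots> = (\<integral>y. \<integral>v. ?J (v, y) \<partial>lborel \<partial>lborel)"
    using lborel_pair.Fubini_integral[OF J_int] by simp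
  also have "\<dots> = (\<integral>y. measure lborel (ball (0::'c) 1) *\<^sub>R G y \<partial>lborel)"
  proof (intro Bochner_Integration.integral_cong refl)
    fix y
    have "(\<integral>v. indicator (ball 0 1) (P y - v) \<partial>lborel) = measure lborel (ball (0::'c) 1)"
      by (subst integral_eq_nn_integral) (auto simp: shift ennreal_indicator measure_def)
    moreover have "integrable lborel (\<lambda>v. indicator (ball 0 1) (P y - v) :: real)"
      using vol by (intro integrableI_bounded) (auto simp: shift ennreal_indicator)
    ultimately show "(\<integral>v. ?J (v, y) \<partial>lborel) = measure lborel (ball (0::'c) 1) *\<^sub>R G y"
      by simp
  qed
  also have "\<dots> = measure lborel (ball (0::'c) 1) *\<^sub>R (\<integral>y. G y \<partial>lborel)" by simp
  finally show ?thesis using vol0 by simp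
qed

lemma nn_integral_norm_powr_finite:
  fixes s R :: real
  assumes s: "s < real DIM('a::euclidean_space)" and R: "R > 0"
  shows "(\<integral>\<^sup>+y. indicator (ball 0 R) y * ennreal (norm y powr - s) \<partial>(lborel :: 'a measure)) < \<infinity>"
proof -
  let ?N = "DIM('a)"
  obtain N' where N': "?N = Suc N'" using DIM_positive[where 'a='a] by (cases ?N) auto
  have "((\<lambda>r. r powr (real N' - s)) has_integral (R powr (real N' - s + 1) / (real N' - s
    + 1))) {0..R}"
    using s N' R by (intro has_integral_powr_from_0) auto
  then have rad: "(\<integral>\<^sup>+r. ennreal (r powr (real N' - s)) * indicator {0..R} r \<partial>lborel) < \<infinity>"
    by (subst nn_integral_has_integral_lebesgue') auto
  have "(\<integral>\<^sup>+y. indicator (ball 0 R) y * ennreal (norm y powr - s) \<partial>(lborel :: 'a measure))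
    = ennreal (real ?N) * (\<integral>\<^sup>+x. \<integral>\<^sup>+r. indicator (ball 0 1 - {0}) x
      * (indicator {0<..} r * ennreal (r ^ (?N - 1)))
        * (indicator (ball 0 R) ((r / norm x) *\<^sub>R x)
          * ennreal (norm ((r / norm x) *\<^sub>R x) powr - s)) \<partial>lborel \<partial>(lborel :: 'a measure))"
    by (rule nn_integral_polar) measurable
  also have "\<dots> \<le> ennreal (real ?N) * (\<integral>\<^sup>+x. \<integral>\<^sup>+r. indicator (ball 0 1) x
    * (ennreal (r powr (real N' - s)) * indicator {0..R} r) \<partial>lborel \<partial>(lborel :: 'a measure))"
  proof (intro mult_left_mono nn_integral_mono)
    fix x :: 'a and r :: real
    have "ennreal (r ^ N') * ennreal (r powr - s) = ennreal (r powr (real N' - s))" if "r > 0"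
      using that by (simp add: ennreal_mult'[symmetric] powr_realpow[symmetric] powr_add[symmetric])
    then show "indicator (ball 0 1 - {0}) x * (indicator {0<..} r * ennreal (r ^ (?N - 1)))
        * (indicator (ball 0 R) ((r / norm x) *\<^sub>R x) * ennreal (norm ((r / norm x) *\<^sub>R x) powr - s))
      \<le> indicator (ball 0 1) x * (ennreal (r powr (real N' - s)) * indicator {0..R} r)"
      by (auto simp: N' indicator_def)
  qed simp
  also have "\<dots> = ennreal (real ?N) * (emeasure lborel (ball (0::'a) 1) *
    (\<integral>\<^sup>+r. ennreal (r powr (real N' - s)) * indicator {0..R} r \<partial>lborel))"
    by (simp add: nn_integral_cmult nn_integral_multc)
  also have "\<dots> < \<infinity>"
    using rad emeasure_lborel_ball_finite[of "0::'a" 1]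
      by (simp add: ennreal_mult_less_top less_top)
  finally show ?thesis .
qed

lemma integrable_translate:
  fixes f :: "'a::euclidean_space \<Rightarrow> 'b::{banach,second_countable_topology}"
  assumes "integrable lborel f"
  shows "integrable lborel (\<lambda>x. f (x + a))"
proof -
  have [measurable]: "f \<in> borel_measurable borel" using assms by auto
  have "integrable (distr lborel borel ((+) a)) f" using assms by (simp add: lborel_distr_plus)
  then show ?thesis by (simp add: integrable_distr_eq add.commute)
qed

lemma integral_sphere_measure:
  fixes g :: "real^'n \<Rightarrow> 'b::{banach,second_countable_topology}"
  assumes g: "g \<in> borel_measurable (restrict_space borel (sphere 0 1))"
  shows "(LINT v|sphere_measure. g v) =
    real CARD('n) *\<^sub>R (\<integral>x. indicator (ball 0 1 - {0}) x *\<^sub>R g ((1 / norm x) *\<^sub>R x) \<partial>lborel)"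
proof -
  let ?R = "restrict_space lborel (ball (0::real^'n) 1 - {0})"
  let ?D = "distr ?R (restrict_space borel (sphere 0 1)) (\<lambda>x. x /\<^sub>R norm x)"
  have proj: "(\<lambda>x. x /\<^sub>R norm x) \<in> ?R \<rightarrow>\<^sub>M restrict_space borel (sphere 0 1)"
    by (intro measurable_restrict_space2 measurable_restrict_space1) (auto simp:
      space_restrict_space)
  have sphere: "(sphere_measure :: (real^'n) measure) = density ?D (\<lambda>_. ennreal (real CARD('n)))"
    unfolding sphere_measure_def
    by (rule measure_eqI) (auto simp: emeasure_density nn_integral_cmult
      ennreal_of_nat_eq_real_of_nat)
  have "(LINT v|sphere_measure. g v) = (\<integral>v. real CARD('n) *\<^sub>R g v \<partial>?D)"
    using g by (subst sphere, subst integral_density) auto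
  also have "\<dots> = real CARD('n) *\<^sub>R (\<integral>v. g v \<partial>?D)" by simp
  also have "(\<integral>v. g v \<partial>?D) = (\<integral>x. g (x /\<^sub>R norm x) \<partial>?R)"
    using g proj by (simp add: integral_distr)
  also have "\<dots> = (\<integral>x. indicator (ball 0 1 - {0}) x *\<^sub>R g (x /\<^sub>R norm x) \<partial>lborel)"
    by (simp add: integral_restrict_space)
  finally show ?thesis by (simp add: divide_inverse)
qed

section \<open>The triangle inequality in mean square\<close>

text \<open>
  Minkowski's inequality for the exponent 2, from the Cauchy--Schwarz inequality; \<open>V\<close> and \<open>D\<close> are
  bounds for the two norms.
\<close>

lemma L2_triangle_nn_integral:
  fixes u v d :: "'a \<Rightarrow> real"
  assumes [measurable]: "v \<in> borel_measurable N" "d \<in> borel_measurable N"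
    and nonneg: "\<And>t. 0 \<le> u t" "\<And>t. 0 \<le> v t" "\<And>t. 0 \<le> d t"
    and u: "\<And>t. u t \<le> v t + d t"
    and V: "(\<integral>\<^sup>+t. ennreal ((v t)\<^sup>2) \<partial>N) \<le> ennreal (V\<^sup>2)" "V \<ge> 0"
    and D: "(\<integral>\<^sup>+t. ennreal ((d t)\<^sup>2) \<partial>N) \<le> ennreal (D\<^sup>2)" "D \<ge> 0"
  shows "(\<integral>\<^sup>+t. ennreal ((u t)\<^sup>2) \<partial>N) \<le> ennreal ((V + D)\<^sup>2)"
proof -
  define I where "I = (\<integral>\<^sup>+t. ennreal (v t) * ennreal (d t) \<partial>N)"
  have "I\<^sup>2 \<le> (\<integral>\<^sup>+t. (ennreal (v t))\<^sup>2 \<partial>N) * (\<integral>\<^sup>+t. (ennreal (d t))\<^sup>2 \<partial>N)"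
    unfolding I_def by (rule Cauchy_Schwarz_nn_integral) measurable
  also have "\<dots> \<le> ennreal (V\<^sup>2) * ennreal (D\<^sup>2)"
    using V D nonneg by (intro mult_mono) (simp_all add: ennreal_power)
  also have "\<dots> = ennreal ((V * D)\<^sup>2)"
    by (simp add: ennreal_mult'[symmetric] power_mult_distrib)
  finally have I2: "I\<^sup>2 \<le> ennreal ((V * D)\<^sup>2)" .
  then have "I \<noteq> \<infinity>" by (auto simp: power2_eq_square ennreal_top_mult top_unique)
  then obtain r where r: "I = ennreal r" "r \<ge> 0" by (cases I) auto
  have "r\<^sup>2 \<le> (V * D)\<^sup>2" using I2 r by (simp add: ennreal_power)
  then have rVD: "r \<le> V * D" by (rule power2_le_imp_le) (use V D in simp)
  have "(\<integral>\<^sup>+t. ennreal ((u t)\<^sup>2) \<partial>N)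
     \<le> (\<integral>\<^sup>+t. ennreal ((v t)\<^sup>2) + (2 * (ennreal (v t) * ennreal (d t)) + ennreal ((d t)\<^sup>2)) \<partial>N)"
  proof (rule nn_integral_mono)
    fix t
    have "(u t)\<^sup>2 \<le> (v t + d t)\<^sup>2" using nonneg u by (intro power_mono)
    also have "\<dots> = (v t)\<^sup>2 + (2 * (v t * d t) + (d t)\<^sup>2)" by (simp add: power2_sum)
    finally have "ennreal ((u t)\<^sup>2) \<le> ennreal ((v t)\<^sup>2 + (2 * (v t * d t) + (d t)\<^sup>2))"
      by (rule ennreal_leI)
    then show "ennreal ((u t)\<^sup>2) \<le> ennreal ((v t)\<^sup>2)
      + (2 * (ennreal (v t) * ennreal (d t)) + ennreal ((d t)\<^sup>2))"
      using nonneg by (simp add: ennreal_mult)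
  qed
  also have "\<dots> = (\<integral>\<^sup>+t. ennreal ((v t)\<^sup>2) \<partial>N) + (2 * I + (\<integral>\<^sup>+t. ennreal ((d t)\<^sup>2) \<partial>N))"
    unfolding I_def by (subst nn_integral_add; simp add: nn_integral_add nn_integral_cmult)
  also have "\<dots> \<le> ennreal (V\<^sup>2) + (2 * ennreal (V * D) + ennreal (D\<^sup>2))"
    using V D r rVD by (intro add_mono mult_left_mono) (auto intro: ennreal_leI)
  also have "\<dots> = ennreal ((V + D)\<^sup>2)"
  proof -
    have "2 * ennreal (V * D) = ennreal (2 * (V * D))" using V D by (simp add: ennreal_mult)
    then show ?thesis using V D by (simp add: power2_sum ennreal_plus[symmetric] del: ennreal_plus)
  qed
  finally show ?thesis .
qed

section \<open>Tuples and their size\<close>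

lemma tuple_size_nonneg [simp]: "tuple_size y \<ge> 0"
  by (simp add: tuple_size_def sum_nonneg)

lemma tuple_size_eq_0_iff [simp]: "tuple_size y = 0 \<longleftrightarrow> y = 0"
  by (simp add: tuple_size_def sum_nonneg_eq_0_iff vec_eq_iff)

lemma tuple_size_0 [simp]: "tuple_size 0 = 0"
  by (simp add: tuple_size_def)

lemma tuple_size_pos_iff [simp]: "tuple_size y > 0 \<longleftrightarrow> y \<noteq> 0"
  using tuple_size_nonneg[of y] tuple_size_eq_0_iff[of y] by linarith

lemma tuple_size_scaleR [simp]: "tuple_size (c *\<^sub>R y) = \<bar>c\<bar> * tuple_size y"
  by (simp add: tuple_size_def sum_distrib_left)

lemma tuple_size_minus_commute: "tuple_size (y - z) = tuple_size (z - y)"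
  by (simp add: tuple_size_def norm_minus_commute)

lemma tuple_size_triangle: "tuple_size (y + z) \<le> tuple_size y + tuple_size z"
  unfolding tuple_size_def sum.distrib[symmetric]
  by (intro sum_mono) (simp add: norm_triangle_ineq)

lemma tuple_size_diff_le: "\<bar>tuple_size y - tuple_size z\<bar> \<le> tuple_size (y - z)"
  using tuple_size_triangle[of "y - z" z] tuple_size_triangle[of "z - y" y]
    tuple_size_minus_commute[of y z]
  by simp

lemma norm_le_tuple_size: "norm y \<le> tuple_size y"
  unfolding tuple_size_def norm_vec_def by (rule L2_set_le_sum) simp

lemma norm_nth_le_tuple_size: "norm (y $ i) \<le> tuple_size y"
  unfolding tuple_size_def by (rule member_le_sum) auto

lemma tuple_size_le:
  fixes y :: "(real^'n)^'m"
  shows "(\<And>i. norm (y $ i) \<le> r) \<Longrightarrow> tuple_size y \<le> real CARD('m) * r"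
  unfolding tuple_size_def by (rule sum_bounded_above) simp

lemma continuous_on_tuple_size [continuous_intros]:
  "continuous_on A f \<Longrightarrow> continuous_on A (\<lambda>x. tuple_size (f x))"
  unfolding tuple_size_def by (intro continuous_intros)

lemma tuple_size_measurable [measurable]: "tuple_size \<in> borel_measurable borel"
  by (intro borel_measurable_continuous_onI continuous_intros)

lemma tuple_normalize_diff_le:
  assumes "y \<noteq> 0" "z \<noteq> 0"
  shows "tuple_size (tuple_normalize y - tuple_normalize z) \<le> 2 * tuple_size (y - z) / tuple_size y"
proof -
  let ?a = "tuple_size y" and ?b = "tuple_size z"
  have a: "?a > 0" and b: "?b > 0" using assms by auto
  have "tuple_normalize y - tuple_normalize z = (1 / ?a) *\<^sub>R (y - z) + (1 / ?a - 1 / ?b) *\<^sub>R z"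
    by (simp add: tuple_normalize_def algebra_simps divide_inverse)
  then have "tuple_size (tuple_normalize y - tuple_normalize z) \<le> \<bar>1 / ?a\<bar> * tuple_size (y - z)
    + \<bar>1 / ?a - 1 / ?b\<bar> * ?b"
    using tuple_size_triangle[of "(1 / ?a) *\<^sub>R (y - z)" "(1 / ?a - 1 / ?b) *\<^sub>R z"] by simp
  also have "\<bar>1 / ?a - 1 / ?b\<bar> * ?b = \<bar>(1 / ?a - 1 / ?b) * ?b\<bar>"
    using b by (simp add: abs_mult)
  also have "(1 / ?a - 1 / ?b) * ?b = (?b - ?a) / ?a"
    using a b by (simp add: field_simps)
  also have "\<bar>(?b - ?a) / ?a\<bar> \<le> tuple_size (y - z) / ?a"
    using a tuple_size_diff_le[of z y] by (simp add: divide_right_mono tuple_size_minus_commute)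
  finally show ?thesis using a by (simp add: field_simps)
qed

text \<open>
  With \<open>q = a / b \<in> [0, 2]\<close> the difference is \<open>(1 - q^k) / a^k\<close>, and \<open>1 - q^k\<close> is \<open>1 - q\<close> times a
  geometric sum of at most \<open>k 2^k\<close>.
\<close>

lemma inverse_power_diff_le:
  fixes a b s :: real
  assumes a: "a > 0" and s: "\<bar>a - b\<bar> \<le> s" "2 * s \<le> a"
  shows "\<bar>1 / a ^ k - 1 / b ^ k\<bar> \<le> real k * 2 ^ k * (2 * s / a) / a ^ k"
proof -
  have b: "b \<ge> a / 2" using s by linarith
  define q where "q = a / b"
  have q: "0 \<le> q" "q \<le> 2" using a b by (auto simp: q_def field_simps)
  have b0: "b > 0" using a b by linarith
  have "\<bar>1 - q\<bar> = \<bar>a - b\<bar> / b" using b0 by (simp add: q_def field_simps abs_minus_commute)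
  also have "\<dots> \<le> s / (a / 2)" using s b a by (intro frac_le) auto
  finally have 1: "\<bar>1 - q\<bar> \<le> 2 * s / a" by (simp add: mult.commute)
  have 2: "(\<Sum>i<k. q ^ i) \<le> real k * 2 ^ k"
  proof -
    have "(\<Sum>i<k. q ^ i) \<le> of_nat (card {..<k}) * 2 ^ k"
    proof (rule sum_bounded_above)
      fix i assume "i \<in> {..<k}"
      then have "(2::real) ^ i \<le> 2 ^ k" by (intro power_increasing) auto
      moreover have "q ^ i \<le> 2 ^ i" using q by (intro power_mono)
      ultimately show "q ^ i \<le> 2 ^ k" by linarith
    qed
    then show ?thesis by simp
  qed
  have "1 / a ^ k - 1 / b ^ k = (1 - q ^ k) / a ^ k"
    using a b0 by (simp add: q_def power_divide field_simps)
  also have "1 - q ^ k = (1 - q) * (\<Sum>i<k. q ^ i)" by (rule one_diff_power_eq)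
  finally have "\<bar>1 / a ^ k - 1 / b ^ k\<bar> = \<bar>1 - q\<bar> * (\<Sum>i<k. q ^ i) / a ^ k"
    using a q by (simp add: abs_mult sum_nonneg)
  also have "\<dots> \<le> (2 * s / a) * (real k * 2 ^ k) / a ^ k"
    using 1 2 a q s by (intro divide_right_mono mult_mono) (auto simp: sum_nonneg)
  finally show ?thesis by (simp add: mult_ac)
qed

lemma tuple_upd_conv:
  fixes y :: "(real^'n)^'m"
  shows "tuple_upd y j v = y + axis j (v - y $ j)"
  by (auto simp: tuple_upd_def vec_eq_iff axis_def)

lemma bounded_linear_axis: "bounded_linear (axis j :: real^'n \<Rightarrow> (real^'n)^'m)"
proof (rule bounded_linear_intro)
  fix x :: "real^'n"
  have "tuple_size (axis j x :: (real^'n)^'m) = norm x"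
    by (simp add: tuple_size_def axis_def if_distrib cong: if_cong)
  then show "norm (axis j x :: (real^'n)^'m) \<le> norm x * 1"
    using norm_le_tuple_size[of "axis j x :: (real^'n)^'m"] by simp
qed (simp_all add: vec_eq_iff axis_def)

lemma continuous_on_tuple_upd [continuous_intros]:
  fixes f :: "'b::topological_space \<Rightarrow> real^'n"
  shows "continuous_on A f \<Longrightarrow> continuous_on A (\<lambda>x. tuple_upd y j (f x))"
  unfolding tuple_upd_conv
  by (intro continuous_intros bounded_linear.continuous_on[OF bounded_linear_axis])

lemma tuple_upd_nth: "tuple_upd y j v $ i = (if i = j then v else y $ i)"
  by (simp add: tuple_upd_def)

lemma tuple_size_upd: "tuple_size (tuple_upd y j v) = norm v + (\<Sum>i\<in>UNIV - {j}. norm (y $ i))"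
  unfolding tuple_size_def by (subst sum.remove[of _ j]) (auto simp: tuple_upd_nth)

section \<open>The unit polyball\<close>

definition unit_polyball :: "((real^'n)^'m) set" where
  "unit_polyball = {y. \<forall>i. norm (y $ i) \<le> 1}"

lemma closed_polyball: "closed {y :: (real^'n)^'m. \<forall>i. norm (y $ i) \<le> r}"
  by (intro closed_Collect_all closed_Collect_le continuous_intros)

lemma tuple_size_unit_polyball:
  fixes y :: "(real^'n)^'m"
  shows "y \<in> unit_polyball \<Longrightarrow> tuple_size y \<le> real CARD('m)"
  using tuple_size_le[of y 1] by (simp add: unit_polyball_def)

lemma compact_unit_polyball: "compact (unit_polyball :: ((real^'n)^'m) set)"
proof -
  have "bounded (unit_polyball :: ((real^'n)^'m) set)"
    using order_trans[OF norm_le_tuple_size tuple_size_unit_polyball] by (intro boundedI) blast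
  then show ?thesis
    using closed_polyball[of 1] by (simp add: compact_eq_bounded_closed unit_polyball_def)
qed

lemma polyball_in_borel [measurable]: "{y :: (real^'n)^'m. \<forall>i. norm (y $ i) \<le> r} \<in> sets borel"
  using closed_polyball by (rule borel_closed)

lemma unit_polyball_in_borel [measurable]: "unit_polyball \<in> sets borel"
  unfolding unit_polyball_def by measurable

definition polyshell :: "real \<Rightarrow> ((real^'n)^'m) set" where
  "polyshell h = unit_polyball - {y. \<forall>i. norm (y $ i) \<le> 1 - h}"

lemma polyshell_in_borel [measurable]: "polyshell h \<in> sets borel"
  unfolding polyshell_def by measurable

lemma emeasure_unit_polyball: "emeasure lborel (unit_polyball :: ((real^'n)^'m) set) < \<infinity>"
  using emeasure_lborel_cbox_finite compact_unit_polyball emeasure_compact_finite by blast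

text \<open>
  The polyshell is the difference of two homothetic polyballs, so its relative measure is
  \<open>1 - (1 - h)^(mn)\<close>, which Bernoulli's inequality bounds.
\<close>

lemma measure_polyshell_le:
  assumes h: "0 \<le> h" "h < 1"
  shows "measure lborel (polyshell h :: ((real^'n)^'m) set)
    \<le> real (CARD('m) * CARD('n)) * h * measure lborel (unit_polyball :: ((real^'n)^'m) set)"
proof -
  let ?Q = "unit_polyball :: ((real^'n)^'m) set" and ?N = "CARD('m) * CARD('n)"
  let ?Q' = "{y :: (real^'n)^'m. \<forall>i. norm (y $ i) \<le> 1 - h}"
  have sub: "?Q' \<subseteq> ?Q"
  proof
    fix y assume "y \<in> ?Q'"
    then have "norm (y $ i) \<le> 1 - h" for i by simp
    then have "norm (y $ i) \<le> 1" for i using h(1) by (smt (verit))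
    then show "y \<in> ?Q" by (simp add: unit_polyball_def)
  qed
  have "measure lborel ?Q' = (\<integral>y. indicator ?Q' y \<partial>lborel)" by simp
  also have "\<dots> = (1 - h) ^ ?N *\<^sub>R (\<integral>y. indicator ?Q' ((1 - h) *\<^sub>R y) \<partial>lborel)"
    using h by (subst integral_scaleR_lborel[where c="1 - h"]) auto
  also have "(\<lambda>y. indicator ?Q' ((1 - h) *\<^sub>R y)) = (indicator ?Q :: _ \<Rightarrow> real)"
    using h by (auto simp: fun_eq_iff indicator_def unit_polyball_def)
  finally have *: "measure lborel ?Q' = (1 - h) ^ ?N * measure lborel ?Q" by simp
  have "measure lborel (polyshell h :: ((real^'n)^'m) set) = measure lborel ?Q - measure lborel ?Q'"
    unfolding polyshell_def using sub emeasure_unit_polyball[where 'm='m and 'n='n]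
      by (intro measure_Diff) auto
  also have "\<dots> = (1 - (1 - h) ^ ?N) * measure lborel ?Q" unfolding *
    by (simp add: left_diff_distrib)
  also have "\<dots> \<le> (real ?N * h) * measure lborel ?Q"
    using Bernoulli_inequality[of "- h" ?N] h by (intro mult_right_mono) auto
  finally show ?thesis by simp
qed

section \<open>The kernel\<close>

text \<open>
  The degree \<open>M\<close> of the singularity is a parameter, tied to the dimensions by an equation, so that
  the arithmetic of \<open>CARD('n) - 1\<close> on natural numbers stays in one place.
\<close>

locale marcinkiewicz_kernel =
  fixes \<Omega> :: "(real^'n)^'m \<Rightarrow> complex" and \<beta> C\<^sub>0 :: real and M :: nat
  assumes M_def: "M = CARD('m) * (CARD('n) - 1)"
    and homogeneous: "c > 0 \<Longrightarrow> \<Omega> (c *\<^sub>R y) = \<Omega> y"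
    and beta: "0 < \<beta>" "\<beta> < 1" and C0: "C\<^sub>0 > 0"
    and regular: "\<xi> \<noteq> 0 \<Longrightarrow> \<eta> \<noteq> 0 \<Longrightarrow>
      norm (\<Omega> \<xi> - \<Omega> \<eta>) \<le> C\<^sub>0 * tuple_size (tuple_normalize \<xi> - tuple_normalize \<eta>) powr \<beta>"
    and mean_zero: "(LINT v|sphere_measure. \<Omega> (tuple_upd y j v)) = 0"
begin

definition "sup_norm = (SUP y. norm (\<Omega> y))"

lemma norm_Omega_le: "norm (\<Omega> y) \<le> sup_norm"
proof -
  \<comment> \<open>Normalised tuples are at distance at most 2, so \<open>\<Omega>\<close> deviates boundedly from its value at \<open>e\<close>.\<close>
  obtain e :: "(real^'n)^'m" where e: "e \<noteq> 0"
    by (metis vector_one_nth zero_index zero_neq_one vec_component one_index)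
  have "norm (\<Omega> y) \<le> max (norm (\<Omega> 0)) (norm (\<Omega> e) + C\<^sub>0 * 2 powr \<beta>)" for y
  proof (cases "y = 0")
    case False
    have n: "tuple_size (tuple_normalize z) = 1" if "z \<noteq> 0" for z :: "(real^'n)^'m"
      using that by (simp add: tuple_normalize_def)
    have "tuple_size (tuple_normalize y - tuple_normalize e) \<le> tuple_size (tuple_normalize y)
      + tuple_size (- tuple_normalize e)"
      using tuple_size_triangle[of "tuple_normalize y" "- tuple_normalize e"] by simp
    also have "tuple_size (- tuple_normalize e) = tuple_size (tuple_normalize e)"
      using tuple_size_scaleR[of "-1" "tuple_normalize e"] by simp
    finally have "tuple_size (tuple_normalize y - tuple_normalize e) powr \<beta> \<le> 2 powr \<beta>"
      using False e beta by (intro powr_mono2) (simp_all add: n)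
    then have "norm (\<Omega> y - \<Omega> e) \<le> C\<^sub>0 * 2 powr \<beta>"
      using regular[OF False e] C0 by (smt (verit) mult_left_mono)
    then show ?thesis using norm_triangle_ineq2[of "\<Omega> y" "\<Omega> e"] by linarith
  qed simp
  then have "bdd_above (range (\<lambda>y. norm (\<Omega> y)))" by (intro bdd_aboveI2)
  then show ?thesis unfolding sup_norm_def by (rule cSUP_upper[OF UNIV_I])
qed

lemma sup_norm_nonneg: "sup_norm \<ge> 0"
  using norm_Omega_le[of 0] norm_ge_zero order_trans by blast

lemma Omega_holder:
  assumes "y \<noteq> 0" "z \<noteq> 0"
  shows "norm (\<Omega> y - \<Omega> z) \<le> C\<^sub>0 * (2 * tuple_size (y - z) / tuple_size y) powr \<beta>"
proof -
  have "tuple_size (tuple_normalize y - tuple_normalize z) powr \<beta>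
    \<le> (2 * tuple_size (y - z) / tuple_size y) powr \<beta>"
    using assms beta by (intro powr_mono2 tuple_normalize_diff_le) auto
  then show ?thesis using regular[OF assms] C0 by (smt (verit) mult_left_mono)
qed

lemma continuous_on_Omega: "continuous_on (- {0}) \<Omega>"
  unfolding continuous_on_def
proof
  fix y :: "(real^'n)^'m" assume "y \<in> - {0}"
  then have y: "y \<noteq> 0" by simp
  let ?F = "at y within - {0}"
  have "((\<lambda>z. 2 * tuple_size (y - z) / tuple_size y) \<longlongrightarrow> 2 * tuple_size (y - y) / tuple_size y) ?F"
    by (intro tendsto_intros continuous_on_tendsto_compose[where s=UNIV and f=tuple_size])
      (auto intro!: continuous_intros simp: y)
  then have "((\<lambda>z. C\<^sub>0 * (2 * tuple_size (y - z) / tuple_size y) powr \<beta>) \<longlongrightarrow> 0) ?F"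
    using beta by (intro tendsto_mult_right_zero tendsto_zero_powrI[where b=\<beta>]) auto
  moreover have "\<forall>\<^sub>F z in ?F. norm (\<Omega> z - \<Omega> y) \<le> C\<^sub>0
    * (2 * tuple_size (y - z) / tuple_size y) powr \<beta>"
    using Omega_holder[OF y] by (auto simp: eventually_at_filter norm_minus_commute intro!:
      always_eventually)
  ultimately have "((\<lambda>z. \<Omega> z - \<Omega> y) \<longlongrightarrow> 0) ?F"
    by (rule Lim_null_comparison[rotated])
  then show "(\<Omega> \<longlongrightarrow> \<Omega> y) ?F" by (simp add: LIM_zero_iff)
qed

lemma Omega_measurable [measurable]: "\<Omega> \<in> borel_measurable borel"
proof -
  have "(\<lambda>y. indicator (- {0}) y *\<^sub>R \<Omega> y) \<in> borel_measurable borel"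
    by (intro borel_measurable_continuous_on_indicator continuous_on_Omega) auto
  then have "(\<lambda>y. indicator (- {0}) y *\<^sub>R \<Omega> y + indicator {0} y *\<^sub>R \<Omega> 0) \<in> borel_measurable borel"
    by measurable
  also have "(\<lambda>y. indicator (- {0}) y *\<^sub>R \<Omega> y + indicator {0} y *\<^sub>R \<Omega> 0) = \<Omega>"
    by (auto simp: fun_eq_iff indicator_def)
  finally show ?thesis .
qed

text \<open>
  The value at \<open>0\<close> is set to zero because \<open>0 ^ M = 1\<close> when \<open>n = 1\<close>; the bound by the majorant below
  then holds at every point and not only almost everywhere.
\<close>

definition kernel :: "(real^'n)^'m \<Rightarrow> complex" where
  "kernel y = (if y \<in> unit_polyball \<and> y \<noteq> 0 then \<Omega> y / of_real (tuple_size y ^ M) else 0)"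

lemma kernel_measurable [measurable]: "kernel \<in> borel_measurable borel"
  unfolding kernel_def by measurable

text \<open>
  One integrable function that controls both the kernel and its increments: it is more singular
  than the kernel by \<open>|y|^(-\<beta>)\<close>, and it is integrable because \<open>m(n - 1) + \<beta> < mn\<close>.
\<close>

definition majorant :: "(real^'n)^'m \<Rightarrow> real" where
  "majorant y = indicator unit_polyball y * tuple_size y powr - (real M + \<beta>)"

lemma majorant_nonneg: "majorant y \<ge> 0"
  by (simp add: majorant_def)

lemma majorant_integrable: "integrable lborel majorant"
proof (rule integrableI_bounded)
  have s: "real M + \<beta> < real DIM((real^'n)^'m)"
  proof -
    have "M + 1 \<le> CARD('m) * CARD('n)"
      unfolding M_def by (cases "CARD('n)") auto
    then have "real M + 1 \<le> real (CARD('m) * CARD('n))" by linarith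
    then show ?thesis using beta by simp
  qed
  have "(\<integral>\<^sup>+y. ennreal (norm (majorant y)) \<partial>lborel)
      \<le> (\<integral>\<^sup>+y. indicator (ball 0 (real CARD('m) + 1)) y
        * ennreal (norm y powr - (real M + \<beta>)) \<partial>(lborel :: ((real^'n)^'m) measure))"
  proof (rule nn_integral_mono)
    fix y :: "(real^'n)^'m"
    show "ennreal (norm (majorant y)) \<le> indicator (ball 0 (real CARD('m) + 1)) y
      * ennreal (norm y powr - (real M + \<beta>))"
    proof (cases "y \<in> unit_polyball \<and> y \<noteq> 0")
      case True
      have "norm y < real CARD('m) + 1"
        using True norm_le_tuple_size[of y] tuple_size_unit_polyball[of y] by linarith
      moreover have "tuple_size y powr - (real M + \<beta>) \<le> norm y powr - (real M + \<beta>)"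
        using True norm_le_tuple_size[of y] beta by (intro powr_mono2') auto
      ultimately show ?thesis using True by (simp add: majorant_def ennreal_leI)
    qed (auto simp: majorant_def)
  qed
  also have "\<dots> < \<infinity>" by (rule nn_integral_norm_powr_finite[OF s]) simp
  finally show "(\<integral>\<^sup>+y. ennreal (norm (majorant y)) \<partial>lborel) < \<infinity>" .
qed (unfold majorant_def, measurable)

lemma norm_kernel_le: "norm (kernel y) \<le> sup_norm * tuple_size y powr \<beta> * majorant y"
proof (cases "y \<in> unit_polyball \<and> y \<noteq> 0")
  case True
  then have p: "tuple_size y > 0" by simp
  have "tuple_size y powr \<beta> * tuple_size y powr - (real M + \<beta>) = tuple_size y powr (- real M)"
    by (simp add: powr_add[symmetric] del: of_nat_mult)
  also have "\<dots> = 1 / tuple_size y ^ M"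
    using p by (simp only: powr_minus powr_realpow inverse_eq_divide)
  finally have "sup_norm * tuple_size y powr \<beta> * majorant y = sup_norm / tuple_size y ^ M"
    using True by (simp add: majorant_def mult.assoc del: of_nat_mult)
  moreover have "norm (kernel y) = norm (\<Omega> y) / tuple_size y ^ M"
    using True by (simp add: kernel_def norm_divide norm_power)
  ultimately show ?thesis
    using norm_Omega_le[of y] p by (simp add: divide_right_mono)
qed (auto simp: kernel_def majorant_def)

lemma kernel_integrable: "integrable lborel kernel"
proof (rule Bochner_Integration.integrable_bound)
  show "integrable lborel (\<lambda>y. (sup_norm * real CARD('m) powr \<beta>) * majorant y)"
    using majorant_integrable by simp
  show "AE y in lborel. norm (kernel y) \<le> norm ((sup_norm * real CARD('m) powr \<beta>) * majorant y)"
  proof (rule AE_I2)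
    fix y :: "(real^'n)^'m"
    show "norm (kernel y) \<le> norm ((sup_norm * real CARD('m) powr \<beta>) * majorant y)"
    proof (cases "y \<in> unit_polyball")
      case True
      then have "tuple_size y powr \<beta> \<le> real CARD('m) powr \<beta>"
        using tuple_size_unit_polyball beta by (intro powr_mono2) auto
      then have "sup_norm * tuple_size y powr \<beta> * majorant y \<le> sup_norm * real CARD('m) powr \<beta>
        * majorant y"
        using sup_norm_nonneg majorant_nonneg by (intro mult_right_mono mult_left_mono) auto
      then show ?thesis
        using norm_kernel_le[of y] sup_norm_nonneg majorant_nonneg[of y] by (simp add: abs_mult)
    qed (simp add: kernel_def)
  qed
qed simp

lemma kernel_times_integrable:
  fixes P :: "(real^'n)^'m \<Rightarrow> complex"
  assumes P: "continuous_on UNIV P"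
  shows "integrable lborel (\<lambda>y. kernel y * P y)"
proof -
  have [measurable]: "P \<in> borel_measurable borel" using P by (rule borel_measurable_continuous_onI)
  have "compact (P ` unit_polyball)"
    using P compact_unit_polyball by (blast intro: compact_continuous_image continuous_on_subset)
  then have "bounded (P ` unit_polyball)" by (rule compact_imp_bounded)
  then obtain B where "\<forall>z \<in> P ` unit_polyball. norm z \<le> B"
    unfolding bounded_iff ..
  then have B: "norm (P y) \<le> B" if "y \<in> unit_polyball" for y
    using that by blast
  show ?thesis
  proof (rule Bochner_Integration.integrable_bound)
    show "integrable lborel (\<lambda>y. B * norm (kernel y))"
      using kernel_integrable by simp
    show "AE y in lborel. norm (kernel y * P y) \<le> norm (B * norm (kernel y))"
    proof (rule AE_I2)
      fix y
      show "norm (kernel y * P y) \<le> norm (B * norm (kernel y))"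
      proof (cases "y \<in> unit_polyball")
        case True
        then have "norm (kernel y) * norm (P y) \<le> norm (kernel y) * \<bar>B\<bar>"
          using B[of y] by (intro mult_left_mono) auto
        then show ?thesis by (simp add: norm_mult abs_mult mult.commute)
      qed (simp add: kernel_def)
    qed
  qed measurable
qed

text \<open>
  On the sphere \<open>|v| = r\<close> the size of the tuple and the membership in the polyball are constant,
  and by homogeneity \<open>\<Omega>\<close> takes there the values that it takes on the unit sphere with the other
  entries divided by \<open>r\<close>. So the cancellation of \<open>\<Omega>\<close> on the unit sphere applies for every \<open>r\<close>.
\<close>

lemma integral_kernel_slice: "(\<integral>v. kernel (tuple_upd y j v) \<partial>lborel) = 0"
proof (rule integral_eq_0_spheres)
  fix r :: real assume r: "r > 0"
  define \<rho> where "\<rho> = r + (\<Sum>i\<in>UNIV - {j}. norm (y $ i))"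
  define c :: complex where "c = (if r \<le> 1 \<and> (\<forall>i. i \<noteq> j \<longrightarrow> norm (y $ i)
    \<le> 1) then 1 / of_real (\<rho> ^ M) else 0)"
  let ?g = "\<lambda>v. \<Omega> (tuple_upd ((1 / r) *\<^sub>R y) j v)"
  have nz: "tuple_upd z j v \<noteq> 0" if "v \<noteq> 0" for z :: "(real^'n)^'m" and v
    using that by (metis tuple_upd_nth zero_index)
  have "continuous_on (sphere 0 1) ?g"
  proof (rule continuous_on_compose2[OF continuous_on_Omega])
    show "(\<lambda>v. tuple_upd ((1 / r) *\<^sub>R y) j v) ` sphere 0 1 \<subseteq> - {0}"
    proof
      fix z assume "z \<in> (\<lambda>v. tuple_upd ((1 / r) *\<^sub>R y) j v) ` sphere 0 1"
      then obtain v where "z = tuple_upd ((1 / r) *\<^sub>R y) j v" "v \<noteq> 0" by force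
      then show "z \<in> - {0}" using nz by simp
    qed
  qed (intro continuous_intros)
  then have "?g \<in> borel_measurable (restrict_space borel (sphere 0 1))"
    by (rule borel_measurable_continuous_on_restrict)
  then have g0: "(\<integral>x. indicator (ball 0 1 - {0}) x *\<^sub>R ?g ((1 / norm x) *\<^sub>R x) \<partial>lborel) = 0"
    using mean_zero[of "(1 / r) *\<^sub>R y" j] by (simp add: integral_sphere_measure)
  have "indicator (ball 0 1 - {0}) x *\<^sub>R kernel (tuple_upd y j ((r / norm x) *\<^sub>R x))
      = c * (indicator (ball 0 1 - {0}) x *\<^sub>R ?g ((1 / norm x) *\<^sub>R x))" for x :: "real^'n"
  proof (cases "x \<in> ball 0 1 - {0}")
    case True
    then have x: "x \<noteq> 0" by simp
    let ?z = "tuple_upd y j ((r / norm x) *\<^sub>R x)"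
    have nr: "norm ((r / norm x) *\<^sub>R x) = r" using x r by simp
    have "?z = r *\<^sub>R tuple_upd ((1 / r) *\<^sub>R y) j ((1 / norm x) *\<^sub>R x)"
      using r by (auto simp: vec_eq_iff tuple_upd_nth)
    then have "\<Omega> ?z = ?g ((1 / norm x) *\<^sub>R x)"
      by (simp only: homogeneous[OF r])
    moreover have "tuple_size ?z = \<rho>" by (simp add: tuple_size_upd nr \<rho>_def del: norm_scaleR)
    moreover have "?z \<in> unit_polyball \<longleftrightarrow> r \<le> 1 \<and> (\<forall>i. i \<noteq> j \<longrightarrow> norm (y $ i) \<le> 1)"
      using nr by (auto simp: unit_polyball_def tuple_upd_nth simp del: norm_scaleR)
    moreover have "?z \<noteq> 0" using x r by (intro nz) simp
    ultimately show ?thesis using True by (auto simp: kernel_def c_def)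
  qed simp
  then have "(\<integral>x. indicator (ball 0 1 - {0}) x *\<^sub>R kernel (tuple_upd y j ((r / norm x) *\<^sub>R x))
    \<partial>lborel)
      = c * (\<integral>x. indicator (ball 0 1 - {0}) x *\<^sub>R ?g ((1 / norm x) *\<^sub>R x) \<partial>lborel)"
    by (simp only: integral_mult_right_zero)
  then show "(\<integral>x. indicator (ball 0 1 - {0}) x *\<^sub>R kernel (tuple_upd y j ((r / norm x) *\<^sub>R x))
    \<partial>lborel) = 0"
    by (simp only: g0 mult_zero_right)
qed

lemma integral_kernel_times_eq_0:
  fixes P :: "(real^'n)^'m \<Rightarrow> complex"
  assumes P: "continuous_on UNIV P" and indep: "\<And>y v. P (tuple_upd y j v) = P y"
  shows "(\<integral>y. kernel y * P y \<partial>lborel) = 0"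
proof (rule integral_eq_0_slices[OF kernel_times_integrable[OF P] bounded_linear_axis[of j]
  bounded_linear_vec_nth[of j]])
  show "axis j v $ j = v" for v :: "real^'n" by simp
  fix y :: "(real^'n)^'m"
  have upd: "y + axis j v = tuple_upd y j (v + y $ j)" for v
    by (simp add: tuple_upd_conv)
  have [measurable]: "tuple_upd y j \<in> borel \<rightarrow>\<^sub>M borel"
    by (intro borel_measurable_continuous_onI continuous_intros)
  have "(\<integral>v. kernel (y + axis j v) * P (y + axis j v) \<partial>lborel) =
    (\<integral>v. kernel (tuple_upd y j (v + y $ j)) * P y \<partial>lborel)"
    by (simp only: upd indep)
  also have "\<dots> = (\<integral>v. kernel (tuple_upd y j v) * P y \<partial>lborel)"
    by (rule integral_translate[where f="\<lambda>v. kernel (tuple_upd y j v) * P y"]) measurable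
  also have "\<dots> = 0" by (simp add: integral_kernel_slice)
  finally show "(\<integral>v. kernel (y + axis j v) * P (y + axis j v) \<partial>lborel) = 0" .
qed

section \<open>The mean modulus of continuity of the kernel\<close>

text \<open>
  The first summand serves the majorant terms of the pointwise bound below, the second one bounds the
  kernel on the shell, where \<open>|y| \<ge> 1/2\<close>.
\<close>

definition "holder_const = (C\<^sub>0 + sup_norm * real M * 2 ^ M + sup_norm) * (3 * real CARD('m)) powr \<beta>
  + sup_norm * 2 ^ M"

text \<open>
  Let \<open>|w|\<close> be the size of \<open>w\<close>. If \<open>|y| \<le> 2|w|\<close>, both values of the kernel are small against the
  majorant, since \<open>|y|^(-M) \<le> (C h)^\<beta> |y|^(-M-\<beta>)\<close>, and likewise at \<open>y + w\<close>. If \<open>|y| > 2|w|\<close> and both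
  points lie in the polyball, the Hoelder regularity of \<open>\<Omega>\<close> and that of \<open>|y|^(-M)\<close> gain the factor
  \<open>(2|w| / |y|)^\<beta>\<close>. If exactly one of the two points lies in the polyball, it lies in the shell of
  width \<open>h\<close>, where the kernel is bounded.
\<close>

lemma kernel_diff_le:
  assumes w: "\<And>i. norm (w $ i) \<le> h" and h: "0 \<le> h" "h \<le> 1/2"
  shows "norm (kernel y - kernel (y + w))
    \<le> holder_const * (h powr \<beta> * (majorant y + majorant (y + w))
        + (indicator (polyshell h) y + indicator (polyshell h) (y + w)))"
proof -
  define a where "a = tuple_size y"
  define b where "b = tuple_size (y + w)"
  define s where "s = tuple_size w"
  define A where "A = (C\<^sub>0 + sup_norm * real M * 2 ^ M + sup_norm) * (3 * real CARD('m)) powr \<beta>"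
  define B where "B = sup_norm * 2 ^ M"
  have hc: "holder_const = A + B" by (simp add: holder_const_def A_def B_def)
  have A0: "A \<ge> 0" and B0: "B \<ge> 0"
    using sup_norm_nonneg C0 by (auto simp: A_def B_def)
  have s: "s \<le> real CARD('m) * h" unfolding s_def using w by (rule tuple_size_le)
  have ab: "\<bar>a - b\<bar> \<le> s"
    using tuple_size_diff_le[of y "y + w"] tuple_size_minus_commute[of y "y + w"]
      by (simp add: a_def b_def s_def)
  have s0: "s \<ge> 0" "a \<ge> 0" "b \<ge> 0" by (simp_all add: s_def a_def b_def)
  let ?H = "(3 * real CARD('m) * h) powr \<beta>"
  have H: "(C\<^sub>0 + sup_norm * real M * 2 ^ M + sup_norm) * ?H = A * h powr \<beta>"
    using h by (simp add: A_def powr_mult)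
  have c: "C\<^sub>0 + sup_norm * real M * 2 ^ M \<le> C\<^sub>0 + sup_norm * real M * 2 ^ M + sup_norm"
    "sup_norm \<le> C\<^sub>0 + sup_norm * real M * 2 ^ M + sup_norm"
    using sup_norm_nonneg C0 by auto
  let ?S = "indicator (polyshell h) y + indicator (polyshell h) (y + w) :: real"
  let ?G = "majorant y + majorant (y + w)"
  have S0: "?S \<ge> 0" by simp
  have G0: "?G \<ge> 0" using majorant_nonneg[of y] majorant_nonneg[of "y + w"] by simp
  have suff: "A * (h powr \<beta> * ?G) + B * ?S \<le> holder_const * (h powr \<beta> * ?G + ?S)"
  proof -
    have "A * u + B * v \<le> (A + B) * (u + v)" if "u \<ge> 0" "v \<ge> 0" for u v
      using A0 B0 that by (simp add: algebra_simps)
    then show ?thesis unfolding hc using G0 S0 by (simp only: mult_nonneg_nonneg powr_ge_zero)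
  qed
  have near: "norm (kernel z) \<le> A * h powr \<beta> * majorant z" if "tuple_size z \<le> 3 * s" for z
  proof -
    have "tuple_size z powr \<beta> \<le> ?H"
      using that s beta by (intro powr_mono2) auto
    then have "sup_norm * tuple_size z powr \<beta> \<le> (C\<^sub>0 + sup_norm * real M * 2 ^ M + sup_norm) * ?H"
      using c(2) sup_norm_nonneg by (intro mult_mono) auto
    then have "sup_norm * tuple_size z powr \<beta> * majorant z \<le> A * h powr \<beta> * majorant z"
      unfolding H by (intro mult_right_mono majorant_nonneg)
    then show ?thesis using norm_kernel_le[of z] by linarith
  qed
  \<comment> \<open>Stated for a general shift \<open>v\<close>, to be used with \<open>w\<close> at \<open>y\<close> and with \<open>-w\<close> at \<open>y + w\<close>.\<close>
  have shell: "norm (kernel z) \<le> B" and shell': "z \<in> polyshell h"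
    if zv: "z \<in> unit_polyball" "z + v \<notin> unit_polyball" "\<And>i. norm (v $ i) \<le> h" for z v
  proof -
    obtain i where i: "norm (z $ i + v $ i) > 1"
      using zv(2) by (auto simp: unit_polyball_def not_le)
    have zi: "norm (z $ i) > 1 - h"
      using i zv(3)[of i] norm_triangle_ineq[of "z $ i" "v $ i"] by linarith
    show "z \<in> polyshell h"
      using zi zv(1) by (auto simp: polyshell_def not_le)
    have p: "tuple_size z \<ge> 1/2"
      using zi norm_nth_le_tuple_size[of z i] h by linarith
    then have z0: "z \<noteq> 0" by auto
    have "norm (kernel z) = norm (\<Omega> z) / tuple_size z ^ M"
      using zv(1) z0 by (simp add: kernel_def norm_divide norm_power)
    also have "\<dots> \<le> sup_norm / (1/2) ^ M"
      using p norm_Omega_le[of z] sup_norm_nonneg by (intro frac_le power_mono) auto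
    finally show "norm (kernel z) \<le> B" by (simp add: B_def power_divide)
  qed
  have "norm (kernel y - kernel (y + w)) \<le> A * (h powr \<beta> * ?G) + B * ?S"
  proof (cases "a \<le> 2 * s")
    case True
    then have "norm (kernel y) \<le> A * h powr \<beta> * majorant y"
      "norm (kernel (y + w)) \<le> A * h powr \<beta> * majorant (y + w)"
      using ab s0 by (auto intro!: near simp: a_def b_def)
    then have "norm (kernel y - kernel (y + w)) \<le> A * (h powr \<beta> * ?G)"
      using norm_triangle_ineq4[of "kernel y" "kernel (y + w)"] by (simp add: algebra_simps)
    then show ?thesis using B0 S0 by (simp add: add_increasing2)
  next
    case far: False
    then have a: "a > 0" and b: "b > 0" using ab s0 by linarith+
    then have nz: "y \<noteq> 0" "y + w \<noteq> 0" by (auto simp: a_def b_def)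
    consider "y \<in> unit_polyball" "y + w \<in> unit_polyball"
      | "y \<in> unit_polyball" "y + w \<notin> unit_polyball"
      | "y \<notin> unit_polyball" "y + w \<in> unit_polyball"
      | "y \<notin> unit_polyball" "y + w \<notin> unit_polyball" by blast
    then show ?thesis
    proof cases
      case 1
      have "kernel y - kernel (y + w)
          = (\<Omega> y - \<Omega> (y + w)) / of_real (a ^ M) + \<Omega> (y + w) * of_real (1 / a ^ M - 1 / b ^ M)"
        using 1 nz by (simp add: kernel_def a_def b_def diff_divide_distrib algebra_simps)
      then have "norm (kernel y - kernel (y + w))
          \<le> norm (\<Omega> y - \<Omega> (y + w)) / a ^ M + norm (\<Omega> (y + w)) * \<bar>1 / a ^ M - 1 / b ^ M\<bar>"
        using norm_triangle_ineq[of "(\<Omega> y - \<Omega> (y + w)) / of_real (a ^ M)" "\<Omega> (y + w)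
          * of_real (1 / a ^ M - 1 / b ^ M)"] a
        by (simp only: norm_divide norm_mult norm_of_real) simp
      also have "\<dots> \<le> (C\<^sub>0 * (2 * s / a) powr \<beta>) / a ^ M + sup_norm
        * (real M * 2 ^ M * (2 * s / a) / a ^ M)"
      proof (intro add_mono divide_right_mono mult_mono)
        show "norm (\<Omega> y - \<Omega> (y + w)) \<le> C\<^sub>0 * (2 * s / a) powr \<beta>"
          using Omega_holder[OF nz] tuple_size_minus_commute[of y "y + w"]
            by (simp add: s_def a_def)
        show "\<bar>1 / a ^ M - 1 / b ^ M\<bar> \<le> real M * 2 ^ M * (2 * s / a) / a ^ M"
          using a ab far by (intro inverse_power_diff_le) auto
      qed (use a norm_Omega_le sup_norm_nonneg in auto)
      also have "\<dots> \<le> (C\<^sub>0 * (2 * s / a) powr \<beta>) / a ^ M + sup_norm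
        * (real M * 2 ^ M * (2 * s / a) powr \<beta> / a ^ M)"
      proof -
        have q: "0 \<le> 2 * s / a" "2 * s / a \<le> 1" using far a s0 by auto
        have "2 * s / a \<le> (2 * s / a) powr \<beta>"
          by (intro ord_eq_le_trans[OF powr_one[OF q(1), symmetric] powr_mono'] less_imp_le[OF
            beta(2)] q)
        with q show ?thesis
          using sup_norm_nonneg a by (intro add_left_mono mult_left_mono divide_right_mono) auto
      qed
      also have "\<dots> = (C\<^sub>0 + sup_norm * real M * 2 ^ M) * ((2 * s / a) powr \<beta> / a ^ M)"
        by (simp add: ring_distribs mult.assoc add_divide_distrib)
      also have "(2 * s / a) powr \<beta> / a ^ M = (2 * s) powr \<beta> * majorant y"
      proof -
        have "majorant y = a powr - (real M + \<beta>)" using 1 by (simp add: majorant_def a_def)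
        also have "\<dots> = 1 / (a ^ M * a powr \<beta>)"
          using a by (simp only: powr_minus powr_add powr_realpow inverse_eq_divide)
        finally show ?thesis using a s0 by (simp add: powr_divide)
      qed
      also have "(C\<^sub>0 + sup_norm * real M * 2 ^ M) * ((2 * s) powr \<beta> * majorant y)
          \<le> (C\<^sub>0 + sup_norm * real M * 2 ^ M + sup_norm) * (?H * majorant y)"
      proof -
        have "2 * s \<le> 3 * real CARD('m) * h" using s s0 by linarith
        then have "(2 * s) powr \<beta> \<le> ?H"
          using beta s0 by (intro powr_mono2) auto
        then have "(2 * s) powr \<beta> * majorant y \<le> ?H * majorant y"
          by (rule mult_right_mono[OF _ majorant_nonneg])
        then show ?thesis
          using majorant_nonneg[of y] sup_norm_nonneg C0 by (intro mult_mono[OF c(1)]) auto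
      qed
      also have "\<dots> = A * (h powr \<beta> * majorant y)"
        using H by (simp add: mult.assoc[symmetric])
      also have "\<dots> \<le> A * (h powr \<beta> * ?G) + B * ?S"
        using A0 B0 S0 majorant_nonneg by (intro add_increasing2 mult_left_mono) auto
      finally show ?thesis .
    next
      case 2
      then have "norm (kernel y - kernel (y + w)) \<le> B * 1"
        using shell[of y w] w by (simp add: kernel_def[of "y + w"])
      also have "\<dots> \<le> B * ?S"
        using shell'[of y w] 2 w B0 by (intro mult_left_mono) auto
      also have "\<dots> \<le> A * (h powr \<beta> * ?G) + B * ?S"
        using A0 G0 by simp
      finally show ?thesis .
    next
      case 3
      then have "norm (kernel y - kernel (y + w)) \<le> B * 1"
        using shell[of "y + w" "- w"] w by (simp add: kernel_def[of y])
      also have "\<dots> \<le> B * ?S"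
        using shell'[of "y + w" "- w"] 3 w B0 by (intro mult_left_mono) auto
      also have "\<dots> \<le> A * (h powr \<beta> * ?G) + B * ?S"
        using A0 G0 by simp
      finally show ?thesis .
    next
      case 4
      then show ?thesis using A0 B0 G0 S0 by (simp add: kernel_def)
    qed
  qed
  then show ?thesis using suff by linarith
qed

lemma holder_const_nonneg: "holder_const \<ge> 0"
  using sup_norm_nonneg C0 by (simp add: holder_const_def)

definition "modulus_const = holder_const * (2 * (\<integral>y. majorant y \<partial>lborel)
    + 2 * (real (CARD('m) * CARD('n)) * measure lborel (unit_polyball :: ((real^'n)^'m) set)))"

text \<open>
  Translation invariance makes the two majorant terms of the pointwise bound equal, and the shells
  have measure at most a multiple of \<open>h \<le> h^\<beta>\<close>.
\<close>

lemma integral_kernel_diff_le: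
  assumes w: "\<And>i. norm (w $ i) \<le> h" and h: "0 \<le> h" "h \<le> 1/2"
  shows "(\<integral>y. norm (kernel y - kernel (y + w)) \<partial>lborel) \<le> modulus_const * h powr \<beta>"
proof -
  let ?S = "polyshell h :: ((real^'n)^'m) set"
  have fin: "emeasure lborel ?S < \<infinity>"
    using emeasure_mono[of ?S unit_polyball lborel] emeasure_unit_polyball[where 'm='m and 'n='n]
    by (auto simp: polyshell_def intro: le_less_trans)
  have iS: "integrable lborel (indicator ?S :: _ \<Rightarrow> real)"
    using fin by (simp add: integrable_indicator_iff)
  have iS': "integrable lborel (\<lambda>y. indicator ?S (y + w) :: real)"
    by (rule integrable_translate[OF iS])
  have iG': "integrable lborel (\<lambda>y. majorant (y + w))"
    by (rule integrable_translate[OF majorant_integrable])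
  have [measurable]: "majorant \<in> borel_measurable borel"
    using majorant_integrable by auto
  have "(\<integral>y. norm (kernel y - kernel (y + w)) \<partial>lborel)
      \<le> (\<integral>y. holder_const * (h powr \<beta> * (majorant y + majorant (y + w))
        + (indicator ?S y + indicator ?S (y + w))) \<partial>lborel)"
    using kernel_integrable integrable_translate[OF kernel_integrable] iS iS' majorant_integrable
      iG'
    by (intro integral_mono kernel_diff_le[OF w h]) auto
  also have "\<dots> = holder_const * (h powr \<beta> * ((\<integral>y. majorant y \<partial>lborel) +
    (\<integral>y. majorant (y + w) \<partial>lborel))
        + ((\<integral>y. indicator ?S y \<partial>lborel) + (\<integral>y. indicator ?S (y + w) \<partial>lborel)))"
    using iS iS' majorant_integrable iG' by simp
  also have "(\<integral>y. majorant (y + w) \<partial>lborel) = (\<integral>y. majorant y \<partial>lborel)"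
    by (rule integral_translate) simp
  also have "(\<integral>y. indicator ?S (y + w) \<partial>lborel) = (\<integral>y. indicator ?S y \<partial>lborel :: real)"
    by (rule integral_translate) simp
  also have "(\<integral>y. indicator ?S y \<partial>lborel) = measure lborel ?S" by simp
  also have "holder_const * (h powr \<beta> * ((\<integral>y. majorant y \<partial>lborel) + (\<integral>y. majorant y \<partial>lborel))
    + (measure lborel ?S + measure lborel ?S))
    \<le> holder_const * (h powr \<beta> * ((\<integral>y. majorant y \<partial>lborel) + (\<integral>y. majorant y \<partial>lborel))
       + 2 * (h powr \<beta> * (real (CARD('m) * CARD('n))
         * measure lborel (unit_polyball :: ((real^'n)^'m) set))))"
  proof (intro mult_left_mono add_left_mono holder_const_nonneg)
    have "h \<le> h powr \<beta>"
      using powr_mono'[of \<beta> 1 h] beta h by (cases "h = 0") auto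
    moreover define V where "V = real (CARD('m) * CARD('n))
      * measure lborel (unit_polyball :: ((real^'n)^'m) set)"
    ultimately have "h * V \<le> h powr \<beta> * V"
      by (intro mult_right_mono) auto
    moreover have "measure lborel ?S \<le> h * V"
      using measure_polyshell_le[of h, where 'm='m and 'n='n] h by (simp add: V_def mult_ac)
    ultimately show "measure lborel ?S + measure lborel ?S \<le> 2
      * (h powr \<beta> * (real (CARD('m) * CARD('n)) * measure lborel (unit_polyball :: ((real^'n)^'m)
        set)))"
      unfolding V_def[symmetric] by linarith
  qed
  also have "\<dots> = modulus_const * h powr \<beta>"
    by (simp add: modulus_const_def algebra_simps)
  finally show ?thesis .
qed

section \<open>The averages as integrals against the kernel\<close>

definition "mass = (\<integral>y. norm (kernel y) \<partial>lborel)"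

definition dilated_avg :: "('m \<Rightarrow> real^'n \<Rightarrow> complex) \<Rightarrow> real \<Rightarrow> real^'n \<Rightarrow> complex" where
  "dilated_avg f t x = (\<integral>y. kernel y * (\<Prod>i\<in>UNIV. f i (x - t *\<^sub>R (y $ i))) \<partial>lborel)"

text \<open>
  The powers of \<open>t\<close> cancel: the dilation contributes \<open>t^(mn)\<close>, the homogeneity of the kernel
  \<open>t^(-m(n-1))\<close>, and the normalisation of the average \<open>t^(-m)\<close>.
\<close>

lemma marcinkiewicz_avg_eq_dilated_avg:
  assumes t: "t > 0" and f: "\<And>i. continuous_on UNIV (f i)"
  shows "marcinkiewicz_avg \<Omega> f t x = dilated_avg f t x"
proof -
  let ?A = "{y :: (real^'n)^'m. \<forall>i. y $ i \<in> cball 0 t}"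
  let ?K = "\<lambda>y. \<Omega> y / of_real (tuple_size y ^ M) * (\<Prod>i\<in>UNIV. f i (x - y $ i))"
  let ?g = "\<lambda>y. kernel ((1 / t) *\<^sub>R y) / of_real (t ^ M) * (\<Prod>i\<in>UNIV. f i (x - y $ i))"
  have [measurable]: "(\<lambda>y :: (real^'n)^'m. \<Prod>i\<in>UNIV. f i (x - y $ i)) \<in> borel_measurable borel"
    by (intro borel_measurable_continuous_onI continuous_intros continuous_on_compose2[OF f]) auto
  have [measurable]: "?A \<in> sets borel"
    using polyball_in_borel[of t, where 'm='m and 'n='n] by simp
  have eq: "indicator ?A y *\<^sub>R ?K y = ?g y" if "y \<noteq> 0" for y
  proof -
    have "\<Omega> ((1 / t) *\<^sub>R y) = \<Omega> y" using t by (intro homogeneous) simp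
    moreover have "(1 / t) *\<^sub>R y \<in> unit_polyball \<longleftrightarrow> y \<in> ?A"
      using t by (simp add: unit_polyball_def)
    moreover have "tuple_size ((1 / t) *\<^sub>R y) ^ M = tuple_size y ^ M / t ^ M"
      using t by (simp add: power_divide)
    ultimately show ?thesis
      using that t by (simp add: kernel_def indicator_def)
  qed
  have "(LINT y:?A|lebesgue. ?K y) = (\<integral>y. indicator ?A y *\<^sub>R ?K y \<partial>lborel)"
    unfolding set_lebesgue_integral_def by (rule integral_completion) measurable
  also have "\<dots> = (\<integral>y. ?g y \<partial>lborel)"
  proof (rule integral_cong_AE)
    show "AE y in lborel. indicator ?A y *\<^sub>R ?K y = ?g y"
      using AE_lborel_singleton[of "0 :: (real^'n)^'m"] by eventually_elim (rule eq)
  qed measurable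
  also have "\<dots> = t ^ DIM((real^'n)^'m) *\<^sub>R (\<integral>y. ?g (t *\<^sub>R y) \<partial>lborel)"
    using t by (intro integral_scaleR_lborel) measurable
  also have "(\<lambda>y. ?g (t *\<^sub>R y)) = (\<lambda>y. 1 / of_real (t ^ M)
    * (kernel y * (\<Prod>i\<in>UNIV. f i (x - t *\<^sub>R (y $ i)))))"
    using t by (simp add: fun_eq_iff)
  also have "(\<integral>y. 1 / of_real (t ^ M) * (kernel y * (\<Prod>i\<in>UNIV. f i (x - t *\<^sub>R (y $ i)))) \<partial>lborel)
    = 1 / of_real (t ^ M) * dilated_avg f t x"
    unfolding dilated_avg_def by (rule integral_mult_right_zero)
  finally have "marcinkiewicz_avg \<Omega> f t x
      = of_real (t ^ DIM((real^'n)^'m) / (t ^ CARD('m) * t ^ M)) * dilated_avg f t x"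
    by (simp add: marcinkiewicz_avg_def M_def[symmetric] scaleR_conv_of_real del: One_nat_def)
  also have "t ^ DIM((real^'n)^'m) = t ^ CARD('m) * t ^ M"
  proof -
    have "CARD('m) * CARD('n) = CARD('m) + M"
      unfolding M_def by (cases "CARD('n)") auto
    then show ?thesis by (simp add: power_add)
  qed
  finally show ?thesis using t by simp
qed

text \<open>
  The constants are inserted one index at a time. Each step changes the integrand by the kernel
  times a product that does not involve the variable \<open>y_j\<close>, and such a product integrates to zero.
\<close>

lemma integral_kernel_prod_shift:
  fixes g :: "'m \<Rightarrow> real^'n \<Rightarrow> complex"
  assumes g: "\<And>i. continuous_on UNIV (g i)"
  shows "(\<integral>y. kernel y * (\<Prod>i\<in>UNIV. g i (y $ i)) \<partial>lborel) =
    (\<integral>y. kernel y * (\<Prod>i\<in>UNIV. g i (y $ i) - c i) \<partial>lborel)"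
proof -
  \<comment> \<open>The shift by \<open>c\<close> restricted to the indices in \<open>S\<close>.\<close>
  define d where "d S i = (if i \<in> S then c i else 0)" for S i
  have cont: "continuous_on UNIV (\<lambda>y :: (real^'n)^'m. \<Prod>i\<in>T. g i (y $ i) - d S i)" for S T
    by (intro continuous_intros continuous_on_compose2[OF g]) auto
  have "(\<integral>y. kernel y * (\<Prod>i\<in>UNIV. g i (y $ i)) \<partial>lborel) =
    (\<integral>y. kernel y * (\<Prod>i\<in>UNIV. g i (y $ i) - d S i) \<partial>lborel)"
    if "finite S" for S
    using that
  proof induction
    case empty
    then show ?case by (simp add: d_def)
  next
    case (insert j S)
    let ?P = "\<lambda>y :: (real^'n)^'m. c j * (\<Prod>i\<in>UNIV - {j}. g i (y $ i) - d S i)"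
    have split: "kernel y * (\<Prod>i\<in>UNIV. g i (y $ i) - d (insert j S) i)
        = kernel y * (\<Prod>i\<in>UNIV. g i (y $ i) - d S i) - kernel y * ?P y" for y
    proof -
      have "(\<Prod>i\<in>UNIV. g i (y $ i) - d (insert j S) i)
          = (g j (y $ j) - c j) * (\<Prod>i\<in>UNIV - {j}. g i (y $ i) - d (insert j S) i)"
        by (subst prod.remove[of _ j]) (auto simp: d_def)
      also have "(\<Prod>i\<in>UNIV - {j}. g i (y $ i) - d (insert j S) i)
        = (\<Prod>i\<in>UNIV - {j}. g i (y $ i) - d S i)"
        by (intro prod.cong) (auto simp: d_def)
      also have "(g j (y $ j) - c j) * \<dots> = (\<Prod>i\<in>UNIV. g i (y $ i) - d S i) - ?P y"
        using insert.hyps by (subst (2) prod.remove[of _ j]) (auto simp: d_def algebra_simps)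
      finally show ?thesis by (simp only: right_diff_distrib)
    qed
    have P: "continuous_on UNIV ?P" by (intro continuous_intros cont)
    have "(\<integral>y. kernel y * ?P y \<partial>lborel) = 0"
      by (rule integral_kernel_times_eq_0[OF P, of j]) (auto simp: tuple_upd_nth intro!: prod.cong)
    then have "(\<integral>y. kernel y * (\<Prod>i\<in>UNIV. g i (y $ i) - d (insert j S) i) \<partial>lborel)
       = (\<integral>y. kernel y * (\<Prod>i\<in>UNIV. g i (y $ i) - d S i) \<partial>lborel)"
      unfolding split
      by (subst Bochner_Integration.integral_diff[OF kernel_times_integrable[OF cont]
        kernel_times_integrable[OF P]]) simp
    then show ?case using insert.IH by simp
  qed
  from this[of UNIV] show ?thesis by (simp add: d_def)
qed

text \<open>
  Square root of the sum of the two integrals over \<open>t < 2\<close> and \<open>t > 2\<close> of the squared bounds for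
  \<open>|F_t(f)(x) - F_t(f)(z)|\<close> against \<open>dt/t\<close>, normalised to \<open>|x - z| = 1\<close> and \<open>\<Lambda> = 1\<close>. It depends
  on the kernel and the exponent only, hence it is a constant uniform in \<open>f\<close>.
\<close>

definition square_const :: "real \<Rightarrow> real" where
  "square_const a = sqrt ((2 * mass)\<^sup>2 * 2 powr (2 * a) / (2 * a)
     + (modulus_const * 2 powr a)\<^sup>2 * 2 powr (2 * a - 2 * \<beta>) / (2 * \<beta> - 2 * a))"

end

section \<open>Averages of Hoelder continuous functions\<close>

lemma holder_imp_continuous:
  fixes f :: "'a::real_normed_vector \<Rightarrow> 'b::real_normed_vector"
  assumes a: "a > 0" and f: "\<And>u v. norm (f u - f v) \<le> L * norm (u - v) powr a"
  shows "continuous_on UNIV f"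
  unfolding continuous_on_def
proof
  fix v :: 'a
  have "((\<lambda>u. norm (u - v)) \<longlongrightarrow> norm (v - v)) (at v)"
    by (intro tendsto_intros)
  then have "((\<lambda>u. L * norm (u - v) powr a) \<longlongrightarrow> 0) (at v)"
    using a by (intro tendsto_mult_right_zero tendsto_zero_powrI[where b=a]) auto
  then have "((\<lambda>u. f u - f v) \<longlongrightarrow> 0) (at v)"
    by (rule Lim_null_comparison[rotated]) (use f in auto)
  then show "(f \<longlongrightarrow> f v) (at v within UNIV)" by (simp add: LIM_zero_iff)
qed

locale marcinkiewicz_holder = marcinkiewicz_kernel \<Omega> \<beta> C\<^sub>0 M
  for \<Omega> :: "(real^'n)^'m \<Rightarrow> complex" and \<beta> C\<^sub>0 :: real and M +
  fixes f :: "'m \<Rightarrow> real^'n \<Rightarrow> complex" and L \<alpha>s :: "'m \<Rightarrow> real"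
  assumes alphas: "\<alpha>s i > 0" and L: "L i \<ge> 0"
    and holder: "norm (f i u - f i v) \<le> L i * norm (u - v) powr \<alpha>s i"
begin

definition "\<alpha> = (\<Sum>i\<in>UNIV. \<alpha>s i)"
definition "\<Lambda> = (\<Prod>i\<in>UNIV. L i)"

lemma Lambda_nonneg: "\<Lambda> \<ge> 0" unfolding \<Lambda>_def using L by (simp add: prod_nonneg)
lemma alpha_pos: "\<alpha> > 0" unfolding \<alpha>_def using alphas by (simp add: sum_pos)

lemma f_continuous: "continuous_on UNIV (f i)"
  by (rule holder_imp_continuous[OF alphas holder])

lemma prod_increment_le:
  assumes t: "t > 0" and y: "\<And>i. norm (y $ i) \<le> r" and r: "r > 0"
  shows "norm (\<Prod>i\<in>UNIV. f i (x - t *\<^sub>R (y $ i)) - f i x) \<le> \<Lambda> * (r * t) powr \<alpha>"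
proof -
  have "norm (\<Prod>i\<in>UNIV. f i (x - t *\<^sub>R (y $ i)) - f i x)
    = (\<Prod>i\<in>UNIV. norm (f i (x - t *\<^sub>R (y $ i)) - f i x))"
    by (rule prod_norm[symmetric])
  also have "\<dots> \<le> (\<Prod>i\<in>UNIV. L i * (r * t) powr \<alpha>s i)"
  proof (intro prod_mono conjI norm_ge_zero)
    fix i
    have "norm (f i (x - t *\<^sub>R (y $ i)) - f i x) \<le> L i * norm (t *\<^sub>R (y $ i)) powr \<alpha>s i"
      using holder[of i "x - t *\<^sub>R (y $ i)" x] by simp
    also have "\<dots> \<le> L i * (r * t) powr \<alpha>s i"
    proof (intro mult_left_mono powr_mono2 L)
      show "norm (t *\<^sub>R (y $ i)) \<le> r * t"
        using y[of i] t by (simp add: mult.commute mult_right_mono)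
    qed (use alphas[of i] in auto)
    finally show "norm (f i (x - t *\<^sub>R (y $ i)) - f i x) \<le> L i * (r * t) powr \<alpha>s i" .
  qed
  also have "\<dots> = \<Lambda> * (r * t) powr \<alpha>"
    using t r by (simp add: prod.distrib \<Lambda>_def \<alpha>_def powr_sum)
  finally show ?thesis .
qed

text \<open>
  With \<open>c = x\<close> this gives the size bound; with the same \<open>c\<close> at two points it makes the two averages
  comparable.
\<close>

lemma dilated_avg_recentred:
  "dilated_avg f t x = (\<integral>y. kernel y * (\<Prod>i\<in>UNIV. f i (x - t *\<^sub>R (y $ i)) - f i c) \<partial>lborel)"
proof -
  have "continuous_on UNIV (\<lambda>u. f i (x - t *\<^sub>R u))" for i
    by (intro continuous_on_compose2[OF f_continuous] continuous_intros) auto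
  from integral_kernel_prod_shift[OF this, where c="\<lambda>i. f i c"] show ?thesis
    by (simp add: dilated_avg_def)
qed

lemma norm_dilated_avg_le:
  assumes t: "t > 0"
  shows "norm (dilated_avg f t x) \<le> mass * \<Lambda> * t powr \<alpha>"
proof -
  have "norm (dilated_avg f t x) \<le> (\<integral>y. norm (kernel y) * (\<Lambda> * t powr \<alpha>) \<partial>lborel)"
    unfolding dilated_avg_recentred[of t x x]
  proof (rule Bochner_Integration.integral_norm_bound_integral[OF kernel_times_integrable])
    show "continuous_on UNIV (\<lambda>y :: (real^'n)^'m. \<Prod>i\<in>UNIV. f i (x - t *\<^sub>R (y $ i)) - f i x)"
      by (intro continuous_on_compose2[OF f_continuous] continuous_intros) auto
    show "integrable lborel (\<lambda>y. norm (kernel y) * (\<Lambda> * t powr \<alpha>))"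
      using kernel_integrable by simp
    fix y
    show "norm (kernel y * (\<Prod>i\<in>UNIV. f i (x - t *\<^sub>R (y $ i)) - f i x)) \<le> norm (kernel y)
      * (\<Lambda> * t powr \<alpha>)"
    proof (cases "y \<in> unit_polyball")
      case True
      then show ?thesis
        using prod_increment_le[OF t, of y 1 x]
        unfolding norm_mult by (intro mult_left_mono) (auto simp: unit_polyball_def)
    qed (simp add: kernel_def)
  qed
  then show ?thesis by (simp add: mass_def mult.assoc)
qed

lemma norm_dilated_avg_diff_le_near:
  assumes t: "t > 0"
  shows "norm (dilated_avg f t x - dilated_avg f t z) \<le> 2 * mass * \<Lambda> * t powr \<alpha>"
  using norm_triangle_ineq4[of "dilated_avg f t x" "dilated_avg f t z"]
    norm_dilated_avg_le[OF t, of x] norm_dilated_avg_le[OF t, of z] by linarith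

text \<open>
  Both averages are recentred at the same values \<open>f_i(x)\<close>; after the translation of the second
  integral by \<open>w\<close> they contain the same product \<open>P\<close>, and the difference falls on the kernel alone.
\<close>

lemma norm_dilated_avg_diff_le_far:
  assumes t: "t > 0" "2 * norm (x - z) \<le> t"
  shows "norm (dilated_avg f t x - dilated_avg f t z)
    \<le> (modulus_const * 2 powr \<alpha>) * \<Lambda> * t powr \<alpha> * (norm (x - z) / t) powr \<beta>"
proof -
  define w :: "(real^'n)^'m" where "w = (\<chi> i. (1 / t) *\<^sub>R (z - x))"
  define h where "h = norm (x - z) / t"
  have h: "0 \<le> h" "h \<le> 1/2" using t by (auto simp: h_def field_simps)
  have w: "norm (w $ i) \<le> h" for i
    using t by (simp add: w_def h_def norm_minus_commute)
  define P where "P y = (\<Prod>i\<in>UNIV. f i (x - t *\<^sub>R (y $ i)) - f i x)" for y :: "(real^'n)^'m"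
  define P' where "P' y = (\<Prod>i\<in>UNIV. f i (z - t *\<^sub>R (y $ i)) - f i x)" for y :: "(real^'n)^'m"
  have P: "continuous_on UNIV P" and P': "continuous_on UNIV P'"
    unfolding P_def P'_def by (intro continuous_on_compose2[OF f_continuous] continuous_intros;
      auto)+
  have [measurable]: "P' \<in> borel_measurable borel" using P'
    by (rule borel_measurable_continuous_onI)
  have PP': "P' (y + w) = P y" for y
    using t by (simp add: P_def P'_def w_def algebra_simps)
  have int: "integrable lborel (\<lambda>y. kernel (y + w) * P y)"
    using integrable_translate[OF kernel_times_integrable[OF P'], of w] by (simp add: PP')
  have "dilated_avg f t z = (\<integral>y. kernel y * P' y \<partial>lborel)"
    unfolding P'_def by (rule dilated_avg_recentred)
  also have "\<dots> = (\<integral>y. kernel (y + w) * P' (y + w) \<partial>lborel)"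
    by (rule integral_translate[symmetric, where f="\<lambda>y. kernel y * P' y"]) measurable
  finally have z: "dilated_avg f t z = (\<integral>y. kernel (y + w) * P y \<partial>lborel)"
    by (simp only: PP')
  have "dilated_avg f t x = (\<integral>y. kernel y * P y \<partial>lborel)"
    unfolding P_def by (rule dilated_avg_recentred)
  then have "dilated_avg f t x - dilated_avg f t z =
    (\<integral>y. (kernel y - kernel (y + w)) * P y \<partial>lborel)"
    unfolding z using kernel_times_integrable[OF P] int by (simp add: left_diff_distrib)
  also have "norm \<dots> \<le> (\<integral>y. norm (kernel y - kernel (y + w)) * (\<Lambda> * (2 * t) powr \<alpha>) \<partial>lborel)"
  proof (rule Bochner_Integration.integral_norm_bound_integral)
    show "integrable lborel (\<lambda>y. (kernel y - kernel (y + w)) * P y)"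
      using kernel_times_integrable[OF P] int by (simp add: left_diff_distrib)
    show "integrable lborel (\<lambda>y. norm (kernel y - kernel (y + w)) * (\<Lambda> * (2 * t) powr \<alpha>))"
      using kernel_integrable integrable_translate[OF kernel_integrable, of w] by simp
    fix y
    show "norm ((kernel y - kernel (y + w)) * P y) \<le> norm (kernel y - kernel (y + w))
      * (\<Lambda> * (2 * t) powr \<alpha>)"
    proof (cases "y \<in> unit_polyball \<or> y + w \<in> unit_polyball")
      case True
      \<comment> \<open>One of the two points is in the polyball and the entries of \<open>w\<close> have norm at most \<open>1/2\<close>.\<close>
      have "norm (y $ i) \<le> 2" for i
      proof -
        have "norm (y $ i) \<le> 1 \<or> norm (y $ i + w $ i) \<le> 1"
          using True by (auto simp: unit_polyball_def)
        moreover have "norm (y $ i) \<le> norm (y $ i + w $ i) + norm (w $ i)"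
          using norm_triangle_ineq4[of "y $ i + w $ i" "w $ i"] by simp
        ultimately show ?thesis using w[of i] h by linarith
      qed
      then show ?thesis
        using prod_increment_le[OF t(1), of y 2 x]
        unfolding norm_mult P_def by (intro mult_left_mono) auto
    qed (simp add: kernel_def)
  qed
  also have "\<dots> = (\<integral>y. norm (kernel y - kernel (y + w)) \<partial>lborel) * (\<Lambda> * (2 * t) powr \<alpha>)"
    by simp
  also have "\<dots> \<le> (modulus_const * h powr \<beta>) * (\<Lambda> * (2 * t) powr \<alpha>)"
    using Lambda_nonneg by (intro mult_right_mono integral_kernel_diff_le[OF w h]) auto
  also have "\<dots> = (modulus_const * 2 powr \<alpha>) * \<Lambda> * t powr \<alpha> * h powr \<beta>"
    using t by (simp add: powr_mult mult_ac)
  finally show ?thesis unfolding h_def .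
qed

lemma dilated_avg_measurable [measurable]: "(\<lambda>t. dilated_avg f t x) \<in> borel_measurable borel"
proof -
  have "continuous_on UNIV (\<lambda>p :: real \<times> ((real^'n)^'m). \<Prod>i\<in>UNIV. f i (x - fst p *\<^sub>R (snd p $ i)))"
    by (intro continuous_on_compose2[OF f_continuous] continuous_intros) auto
  then have [measurable]: "(\<lambda>p :: real \<times> ((real^'n)^'m). \<Prod>i\<in>UNIV. f i (x - fst p *\<^sub>R (snd p $ i)))
    \<in> borel_measurable (borel \<Otimes>\<^sub>M borel)"
    unfolding borel_prod by (rule borel_measurable_continuous_onI)
  have "(\<lambda>(t, y). kernel y * (\<Prod>i\<in>UNIV. f i (x - t *\<^sub>R (y $ i))))
    \<in> borel_measurable (borel \<Otimes>\<^sub>M lborel)"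
    unfolding case_prod_beta' by measurable
  then show ?thesis
    unfolding dilated_avg_def by (rule lborel.borel_measurable_lebesgue_integral)
qed

section \<open>The square function\<close>

definition square_integral :: "real^'n \<Rightarrow> ennreal" where
  "square_integral x = (\<integral>\<^sup>+t. ennreal ((indicator {0<..} t
    * norm (dilated_avg f t x) / sqrt t)\<^sup>2) \<partial>lborel)"

lemma marcinkiewicz_eq: "marcinkiewicz \<Omega> f x = epowr (square_integral x) (1/2)"
proof -
  have "(\<integral>\<^sup>+t\<in>{0<..}. ennreal ((norm (marcinkiewicz_avg \<Omega> f t x))\<^sup>2 / t) \<partial>lebesgue)
     = (\<integral>\<^sup>+t. ennreal ((indicator {0<..} t * norm (dilated_avg f t x) / sqrt t)\<^sup>2) \<partial>lborel)"
    unfolding nn_integral_completion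
    by (intro nn_integral_cong)
      (auto simp: indicator_def power_divide marcinkiewicz_avg_eq_dilated_avg[OF _ f_continuous])
  then show ?thesis by (simp add: marcinkiewicz_def square_integral_def)
qed

text \<open>
  With \<open>H = |x - z|\<close>, the bound \<open>t^\<alpha>\<close> is used for \<open>t < 2H\<close>, where \<open>t^(2\<alpha>-1)\<close> is integrable at \<open>0\<close>, and
  the bound \<open>t^\<alpha> (H/t)^\<beta>\<close> for \<open>t \<ge> 2H\<close>, where \<open>t^(2\<alpha>-2\<beta>-1)\<close> is integrable at infinity because
  \<open>\<alpha> < \<beta>\<close>.
\<close>

lemma square_integral_diff_le:
  assumes ab: "\<alpha> < \<beta>"
  shows "(\<integral>\<^sup>+t. ennreal ((indicator {0<..} t * norm (dilated_avg f t x - dilated_avg f t z) / sqrt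
    t)\<^sup>2) \<partial>lborel)
    \<le> ennreal ((square_const \<alpha> * \<Lambda> * norm (x - z) powr \<alpha>)\<^sup>2)"
proof (cases "x = z")
  case False
  define H where "H = norm (x - z)"
  have H: "H > 0" using False by (simp add: H_def)
  define c\<^sub>1 where "c\<^sub>1 = (2 * mass * \<Lambda>)\<^sup>2"
  define c\<^sub>2 where "c\<^sub>2 = ((modulus_const * 2 powr \<alpha>) * \<Lambda>)\<^sup>2 * H powr (2 * \<beta>)"
  have c0: "c\<^sub>1 \<ge> 0" "c\<^sub>2 \<ge> 0" by (simp_all add: c\<^sub>1_def c\<^sub>2_def)
  let ?u = "\<lambda>t. (indicator {0<..} t * norm (dilated_avg f t x - dilated_avg f t z) / sqrt t)\<^sup>2"
  let ?p = "\<lambda>t. ennreal (t powr (2 * \<alpha> - 1)) * indicator {0..2 * H} t"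
  let ?q = "\<lambda>t. ennreal (t powr (2 * \<alpha> - 2 * \<beta> - 1)) * indicator {2 * H..} t"
  have I1: "(\<integral>\<^sup>+t. ?p t \<partial>lborel) = ennreal ((2 * H) powr (2 * \<alpha>) / (2 * \<alpha>))"
    using has_integral_powr_from_0[of "2 * \<alpha> - 1" "2 * H"] alpha_pos H
    by (intro nn_integral_has_integral_lebesgue') auto
  have I2: "(\<integral>\<^sup>+t. ?q t \<partial>lborel) = ennreal ((2 * H) powr (2 * \<alpha> - 2 * \<beta>) / (2 * \<beta> - 2 * \<alpha>))"
  proof (rule nn_integral_has_integral_lebesgue')
    have "- ((2 * H) powr (2 * \<alpha> - 2 * \<beta>)) / (2 * \<alpha> - 2 * \<beta>)
      = (2 * H) powr (2 * \<alpha> - 2 * \<beta>) / (2 * \<beta> - 2 * \<alpha>)"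
      using ab by (simp add: field_simps)
    then show "((\<lambda>t. t powr (2 * \<alpha> - 2 * \<beta> - 1)) has_integral (2 * H) powr (2 * \<alpha> - 2 * \<beta>) / (2
      * \<beta> - 2 * \<alpha>)) {2 * H..}"
      using has_integral_powr_to_inf[of "2 * \<alpha> - 2 * \<beta> - 1" "2 * H"] ab H by simp
  qed simp
  have sq: "(s powr e)\<^sup>2 = s powr (2 * e)" if "s > 0" for s e :: real
    by (simp add: power2_eq_square powr_add[symmetric])
  have "(\<integral>\<^sup>+t. ennreal (?u t) \<partial>lborel) \<le> (\<integral>\<^sup>+t. ennreal c\<^sub>1 * ?p t + ennreal c\<^sub>2 * ?q t \<partial>lborel)"
  proof (rule nn_integral_mono)
    fix t :: real
    consider "t \<le> 0" | "0 < t" "t < 2 * H" | "0 < t" "2 * H \<le> t" by linarith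
    then show "ennreal (?u t) \<le> ennreal c\<^sub>1 * ?p t + ennreal c\<^sub>2 * ?q t"
    proof cases
      case 1
      then show ?thesis by simp
    next
      case 2
      have "?u t = (norm (dilated_avg f t x - dilated_avg f t z))\<^sup>2 / t"
        using 2 by (simp add: power_divide)
      also have "\<dots> \<le> (2 * mass * \<Lambda> * t powr \<alpha>)\<^sup>2 / t"
        using 2 norm_dilated_avg_diff_le_near[of t x z] by (intro divide_right_mono power_mono) auto
      also have "\<dots> = c\<^sub>1 * t powr (2 * \<alpha> - 1)"
        using 2 by (simp add: c\<^sub>1_def power_mult_distrib sq powr_diff)
      finally have "ennreal (?u t) \<le> ennreal (c\<^sub>1 * t powr (2 * \<alpha> - 1))" by (rule ennreal_leI)
      then show ?thesis using 2 c0 by (simp add: ennreal_mult)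
    next
      case 3
      have "?u t = (norm (dilated_avg f t x - dilated_avg f t z))\<^sup>2 / t"
        using 3 by (simp add: power_divide)
      also have "\<dots> \<le> ((modulus_const * 2 powr \<alpha>) * \<Lambda> * t powr \<alpha> * (H / t) powr \<beta>)\<^sup>2 / t"
        using 3 norm_dilated_avg_diff_le_far[of t x z] unfolding H_def
          by (intro divide_right_mono power_mono) auto
      also have "\<dots> = c\<^sub>2 * t powr (2 * \<alpha> - 2 * \<beta> - 1)"
        using 3 H by (simp add: c\<^sub>2_def power_mult_distrib sq powr_diff powr_divide power_divide)
      finally have "ennreal (?u t) \<le> ennreal (c\<^sub>2 * t powr (2 * \<alpha> - 2 * \<beta> - 1))"
        by (rule ennreal_leI)
      also have "\<dots> = ennreal c\<^sub>2 * ?q t" using 3 c0 by (simp add: ennreal_mult)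
      finally show ?thesis by (simp add: add_increasing)
    qed
  qed
  also have "\<dots> = ennreal c\<^sub>1 * (\<integral>\<^sup>+t. ?p t \<partial>lborel) + ennreal c\<^sub>2 * (\<integral>\<^sup>+t. ?q t \<partial>lborel)"
    by (subst nn_integral_add; simp add: nn_integral_cmult)
  also have "\<dots> = ennreal (c\<^sub>1 * ((2 * H) powr (2 * \<alpha>) / (2 * \<alpha>)) + c\<^sub>2
    * ((2 * H) powr (2 * \<alpha> - 2 * \<beta>) / (2 * \<beta> - 2 * \<alpha>)))"
    unfolding I1 I2 using c0 alpha_pos ab by (simp add: ennreal_mult[symmetric]
      ennreal_plus[symmetric] del: ennreal_plus)
  also have "c\<^sub>1 * ((2 * H) powr (2 * \<alpha>) / (2 * \<alpha>)) + c\<^sub>2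
    * ((2 * H) powr (2 * \<alpha> - 2 * \<beta>) / (2 * \<beta> - 2 * \<alpha>))
    = (square_const \<alpha> * \<Lambda> * H powr \<alpha>)\<^sup>2"
  proof -
    have HH: "H powr (2 * \<beta>) * (2 * H) powr (2 * \<alpha> - 2 * \<beta>) = 2 powr (2 * \<alpha> - 2 * \<beta>)
      * H powr (2 * \<alpha>)"
      using H by (simp add: powr_mult powr_add[symmetric])
    have sc: "(square_const \<alpha>)\<^sup>2 = (2 * mass)\<^sup>2 * 2 powr (2 * \<alpha>) / (2 * \<alpha>)
       + (modulus_const * 2 powr \<alpha>)\<^sup>2 * 2 powr (2 * \<alpha> - 2 * \<beta>) / (2 * \<beta> - 2 * \<alpha>)"
      unfolding square_const_def using alpha_pos ab
        by (intro real_sqrt_pow2 add_nonneg_nonneg divide_nonneg_pos) auto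
    have "c\<^sub>1 * ((2 * H) powr (2 * \<alpha>) / (2 * \<alpha>)) = (2 * mass)\<^sup>2 * 2 powr (2 * \<alpha>) / (2 * \<alpha>)
      * (\<Lambda>\<^sup>2 * H powr (2 * \<alpha>))"
      using H by (simp add: c\<^sub>1_def power_mult_distrib powr_mult)
    moreover have "c\<^sub>2 * ((2 * H) powr (2 * \<alpha> - 2 * \<beta>) / (2 * \<beta> - 2 * \<alpha>))
      = (modulus_const * 2 powr \<alpha>)\<^sup>2 * \<Lambda>\<^sup>2 * (H powr (2 * \<beta>) * (2 * H) powr (2 * \<alpha> - 2 * \<beta>)) / (2
        * \<beta> - 2 * \<alpha>)"
      by (simp add: c\<^sub>2_def power_mult_distrib mult_ac)
    moreover have "(square_const \<alpha> * \<Lambda> * H powr \<alpha>)\<^sup>2 = (square_const \<alpha>)\<^sup>2 * (\<Lambda>\<^sup>2 * H powr (2 * \<alpha>))"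
      using sq[OF H] by (simp add: power_mult_distrib)
    ultimately show ?thesis
      unfolding HH sc by (simp only: distrib_right) (simp add: mult_ac)
  qed
  finally show ?thesis unfolding H_def .
qed simp

lemma square_const_nonneg: "\<alpha> < \<beta> \<Longrightarrow> square_const \<alpha> \<ge> 0"
  unfolding square_const_def using alpha_pos by (intro real_sqrt_ge_zero add_nonneg_nonneg
    divide_nonneg_pos) auto

lemma square_integral_le:
  assumes ab: "\<alpha> < \<beta>" and z: "square_integral z = ennreal (V\<^sup>2)" "V \<ge> 0"
  shows "square_integral x \<le> ennreal ((V + square_const \<alpha> * \<Lambda> * norm (x - z) powr \<alpha>)\<^sup>2)"
  unfolding square_integral_def
proof (rule L2_triangle_nn_integral[OF _ _ _ _ _ _ _ _ square_integral_diff_le[OF ab, of x z]])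
  show "(\<integral>\<^sup>+t. ennreal ((indicator {0<..} t * norm (dilated_avg f t z) / sqrt t)\<^sup>2) \<partial>lborel)
    \<le> ennreal (V\<^sup>2)"
    using z by (simp add: square_integral_def)
  fix t :: real
  show "indicator {0<..} t * norm (dilated_avg f t x) / sqrt t
    \<le> indicator {0<..} t * norm (dilated_avg f t z) / sqrt t
      + indicator {0<..} t * norm (dilated_avg f t x - dilated_avg f t z) / sqrt t"
    using norm_triangle_ineq2[of "dilated_avg f t x" "dilated_avg f t z"]
    by (auto simp: indicator_def add_divide_distrib[symmetric] intro!: divide_right_mono)
qed (use z Lambda_nonneg square_const_nonneg[OF ab] in \<open>auto simp: indicator_def\<close>)

lemma marcinkiewicz_finite_iff: "marcinkiewicz \<Omega> f x < \<infinity> \<longleftrightarrow> square_integral x < \<infinity>"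
  by (cases "square_integral x = \<infinity>") (simp_all add: marcinkiewicz_eq epowr_def top.not_eq_extremum)

lemma square_integral_eq:
  assumes "marcinkiewicz \<Omega> f x < \<infinity>"
  shows "square_integral x = ennreal ((enn2real (marcinkiewicz \<Omega> f x))\<^sup>2)"
proof -
  obtain r where r: "square_integral x = ennreal r" "r \<ge> 0"
    using assms unfolding marcinkiewicz_finite_iff by (cases "square_integral x") auto
  then show ?thesis by (simp add: marcinkiewicz_eq epowr_def powr_half_sqrt)
qed

lemma marcinkiewicz_finite_everywhere:
  assumes ab: "\<alpha> < \<beta>" and z: "marcinkiewicz \<Omega> f z < \<infinity>"
  shows "marcinkiewicz \<Omega> f x < \<infinity>"
  unfolding marcinkiewicz_finite_iff
  using square_integral_le[OF ab square_integral_eq[OF z] enn2real_nonneg, of x]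
  by (rule le_less_trans) simp

lemma marcinkiewicz_le:
  assumes ab: "\<alpha> < \<beta>" and z: "marcinkiewicz \<Omega> f z < \<infinity>"
  shows "enn2real (marcinkiewicz \<Omega> f x)
    \<le> enn2real (marcinkiewicz \<Omega> f z) + square_const \<alpha> * \<Lambda> * norm (x - z) powr \<alpha>"
proof -
  have "ennreal ((enn2real (marcinkiewicz \<Omega> f x))\<^sup>2)
    \<le> ennreal ((enn2real (marcinkiewicz \<Omega> f z) + square_const \<alpha> * \<Lambda> * norm (x - z) powr \<alpha>)\<^sup>2)"
    using square_integral_le[OF ab square_integral_eq[OF z] enn2real_nonneg, of x]
      square_integral_eq[OF marcinkiewicz_finite_everywhere[OF ab z], of x] by simp
  moreover have nonneg: "0 \<le> enn2real (marcinkiewicz \<Omega> f z) + square_const \<alpha> * \<Lambda>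
    * norm (x - z) powr \<alpha>"
    using Lambda_nonneg square_const_nonneg[OF ab] by simp
  ultimately have "(enn2real (marcinkiewicz \<Omega> f x))\<^sup>2
    \<le> (enn2real (marcinkiewicz \<Omega> f z) + square_const \<alpha> * \<Lambda> * norm (x - z) powr \<alpha>)\<^sup>2"
    by (subst (asm) ennreal_le_iff) auto
  then show ?thesis using nonneg by (rule power2_le_imp_le)
qed

lemma Lip_norm_marcinkiewicz_le:
  assumes ab: "\<alpha> < \<beta>" and z: "marcinkiewicz \<Omega> f z < \<infinity>"
  shows "Lip_norm \<alpha> (\<lambda>x. enn2real (marcinkiewicz \<Omega> f x)) \<le> ennreal (square_const \<alpha> * \<Lambda>)"
  unfolding Lip_norm_def
proof (rule SUP_least, clarify)
  fix x y :: "real^'n" assume xy: "x \<noteq> y"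
  note fin = marcinkiewicz_finite_everywhere[OF ab z]
  have "norm (enn2real (marcinkiewicz \<Omega> f x) - enn2real (marcinkiewicz \<Omega> f y)) \<le> square_const \<alpha> * \<Lambda>
    * norm (x - y) powr \<alpha>"
    using marcinkiewicz_le[OF ab fin, of x y] marcinkiewicz_le[OF ab fin, of y x]
    by (simp add: abs_le_iff norm_minus_commute)
  then show "ennreal (norm (enn2real (marcinkiewicz \<Omega> f x) - enn2real (marcinkiewicz \<Omega> f y)) / norm
    (x - y) powr \<alpha>)
    \<le> ennreal (square_const \<alpha> * \<Lambda>)"
    using xy by (intro ennreal_leI) (simp add: divide_le_eq)
qed

end

lemma Lip_space_holder:
  assumes f: "f \<in> Lip_space a"
  shows "norm (f u - f v) \<le> enn2real (Lip_norm a f) * norm (u - v) powr a"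
proof (cases "u = v")
  case False
  have "ennreal (norm (f u - f v) / norm (u - v) powr a) \<le> Lip_norm a f"
    unfolding Lip_norm_def using False by (intro SUP_upper2[of "(u, v)"]) auto
  also have "\<dots> = ennreal (enn2real (Lip_norm a f))"
    using f by (simp add: Lip_space_def)
  finally have "norm (f u - f v) / norm (u - v) powr a \<le> enn2real (Lip_norm a f)"
    by (subst (asm) ennreal_le_iff) auto
  then show ?thesis using False by (simp add: divide_le_eq)
qed simp

theorem theorem1p3:
  fixes \<Omega> :: "(real^'n)^'m \<Rightarrow> complex"
    and \<beta> C\<^sub>0 q :: real
    and qs \<alpha>s :: "'m \<Rightarrow> real"
  assumes homogeneous: "\<And>c y. c > 0 \<Longrightarrow> \<Omega> (c *\<^sub>R y) = \<Omega> y"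
    and beta: "0 < \<beta>" "\<beta> < 1" and C0: "C\<^sub>0 > 0"
    and regular: "\<And>\<xi> \<eta>. \<xi> \<noteq> 0 \<Longrightarrow> \<eta> \<noteq> 0 \<Longrightarrow>
      norm (\<Omega> \<xi> - \<Omega> \<eta>) \<le> C\<^sub>0 * tuple_size (tuple_normalize \<xi> - tuple_normalize \<eta>) powr \<beta>"
    and mean_zero: "\<And>j y. (LINT v|sphere_measure. \<Omega> (tuple_upd y j v)) = 0"
    and qs: "\<And>i. 1 < qs i" and q: "1 / q = (\<Sum>i\<in>UNIV. 1 / qs i)"
    and bounded: "marcinkiewicz_bounded \<Omega> qs q"
    and alphas: "\<And>i. \<alpha>s i > 0" and alpha: "(\<Sum>i\<in>UNIV. \<alpha>s i) < \<beta> / 2"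
  shows "\<exists>C>0. \<forall>f. (\<forall>j. f j \<in> Lip_space (\<alpha>s j)) \<longrightarrow>
    (\<forall>x. marcinkiewicz \<Omega> f x = \<infinity>) \<or>
    ((AE x in lebesgue. marcinkiewicz \<Omega> f x < \<infinity>) \<and>
     (\<exists>g :: real^'n \<Rightarrow> real.
        (\<forall>x. marcinkiewicz \<Omega> f x < \<infinity> \<longrightarrow> g x = enn2real (marcinkiewicz \<Omega> f x)) \<and>
        Lip_norm (\<Sum>i\<in>UNIV. \<alpha>s i) g \<le> ennreal C * (\<Prod>j\<in>UNIV. Lip_norm (\<alpha>s j) (f j))))"
proof -
  interpret marcinkiewicz_kernel \<Omega> \<beta> C\<^sub>0 "CARD('m) * (CARD('n) - 1)"
    using homogeneous beta C0 regular mean_zero by unfold_locales auto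
  define a where "a = (\<Sum>i\<in>UNIV. \<alpha>s i)"
  define C where "C = \<bar>square_const a\<bar> + 1"
  show ?thesis
  proof (intro exI[of _ C] conjI allI impI)
    show "C > 0" by (simp add: C_def)
    fix f :: "'m \<Rightarrow> real^'n \<Rightarrow> complex" assume f: "\<forall>j. f j \<in> Lip_space (\<alpha>s j)"
    define L where "L j = enn2real (Lip_norm (\<alpha>s j) (f j))" for j
    interpret F: marcinkiewicz_holder \<Omega> \<beta> C\<^sub>0 "CARD('m) * (CARD('n) - 1)" f L \<alpha>s
      using f alphas by unfold_locales (auto simp: L_def intro: Lip_space_holder)
    have a: "F.\<alpha> = a" by (simp add: F.\<alpha>_def a_def)
    have ab: "F.\<alpha> < \<beta>" using alpha beta by (simp add: a a_def)
    show "(\<forall>x. marcinkiewicz \<Omega> f x = \<infinity>) \<or>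
    ((AE x in lebesgue. marcinkiewicz \<Omega> f x < \<infinity>) \<and>
     (\<exists>g :: real^'n \<Rightarrow> real.
        (\<forall>x. marcinkiewicz \<Omega> f x < \<infinity> \<longrightarrow> g x = enn2real (marcinkiewicz \<Omega> f x)) \<and>
        Lip_norm (\<Sum>i\<in>UNIV. \<alpha>s i) g \<le> ennreal C * (\<Prod>j\<in>UNIV. Lip_norm (\<alpha>s j) (f j))))"
    proof (cases "\<forall>x. marcinkiewicz \<Omega> f x = \<infinity>")
      case False
      then obtain z where z: "marcinkiewicz \<Omega> f z < \<infinity>" by (auto simp: less_top)
      have "Lip_norm F.\<alpha> (\<lambda>x. enn2real (marcinkiewicz \<Omega> f x)) \<le> ennreal (square_const F.\<alpha> * F.\<Lambda>)"
        by (rule F.Lip_norm_marcinkiewicz_le[OF ab z])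
      also have "\<dots> \<le> ennreal (C * F.\<Lambda>)"
        using F.Lambda_nonneg by (intro ennreal_leI mult_right_mono) (auto simp: C_def a)
      also have "\<dots> = ennreal C * (\<Prod>j\<in>UNIV. ennreal (L j))"
        using F.L by (simp add: F.\<Lambda>_def C_def ennreal_mult' prod_ennreal)
      also have "(\<Prod>j\<in>UNIV. ennreal (L j)) = (\<Prod>j\<in>UNIV. Lip_norm (\<alpha>s j) (f j))"
        using f by (intro prod.cong) (auto simp: L_def Lip_space_def)
      finally show ?thesis
        using F.marcinkiewicz_finite_everywhere[OF ab z]
        by (intro disjI2 conjI exI[of _ "\<lambda>x. enn2real (marcinkiewicz \<Omega> f x)"]) (auto simp: a a_def)
    qed simp
  qed
qed

end
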